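(* Let $T$ be a locally finite tree all of whose vertices have degree $\geq 2$ and let $C>0$. Then for any set of primes $\pi$, the set of locally pro-$\pi$ groups is open in $\mathbf{Sub}(\mathrm{Aut}(T))_{\leq C}^{0}$. In particular, the set of discrete subgroups is open in $\mathbf{Sub}(\mathrm{Aut}(T))_{\leq C}^{0}$.
   Context: $\mathrm{Aut}(T)$ carries the topology of pointwise convergence on vertices. $\mathbf{Sub}(\mathrm{Aut}(T))$ is the space of closed subgroups of $\mathrm{Aut}(T)$ with the Chabauty topology: a base of neighborhoods of $H$ is given by the sets $\{J \mid J\cap K\subseteq HU,\ H\cap K\subseteq JU\}$ with $K$ compact and $U$ an open identity neighborhood. $\mathbf{Sub}(\mathrm{Aut}(T))_{\leq C}^{0}$ is the subspace of those closed subgroups that are unimodular and have at most $C$ orbits on the vertex set of $T$. For a (possibly empty) set of primes $\pi$, a totally disconnected locally compact group is locally pro-$\pi$ if it has an open subgroup which is a pro-$\pi$ group, i.e. a profinite group all of whose finite continuous quotients have order with all prime divisors in $\pi$ (so locally pro-$\varnothing$ means discrete). *)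

theory Defs
  imports
    "HOL-Analysis.Analysis"
    "HOL-Algebra.Bij"
    "HOL-Algebra.Group_Action"
    "HOL-Computational_Algebra.Primes"
begin

section \<open>Topological groups\<close>

text \<open>
  A topological group is a pair of a group \<open>G\<close> and a topology \<open>X\<close> on its carrier. A subgroup
  \<open>H\<close> is regarded as a topological group in its own right through the pair
  \<open>G\<lparr>carrier := H\<rparr>\<close> and \<open>subtopology X H\<close>.
\<close>

definition topological_group :: "('g, 'm) monoid_scheme \<Rightarrow> 'g topology \<Rightarrow> bool" where
  "topological_group G X \<longleftrightarrow>
     group G \<and> topspace X = carrier G \<and>
     continuous_map (prod_topology X X) X (\<lambda>(x, y). x \<otimes>\<^bsub>G\<^esub> y) \<and>
     continuous_map X X (\<lambda>x. inv\<^bsub>G\<^esub> x)"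

definition totally_disconnected_space :: "'g topology \<Rightarrow> bool" where
  "totally_disconnected_space X \<longleftrightarrow> (\<forall>S. connectedin X S \<longrightarrow> (\<exists>a. S \<subseteq> {a}))"

definition profinite_group :: "('g, 'm) monoid_scheme \<Rightarrow> 'g topology \<Rightarrow> bool" where
  "profinite_group G X \<longleftrightarrow>
     topological_group G X \<and> compact_space X \<and> Hausdorff_space X \<and> totally_disconnected_space X"

text \<open>
  The finite continuous quotients of \<open>G\<close> are the finite groups \<open>G Mod N\<close> with \<open>N\<close> an open
  normal subgroup.
\<close>

definition pro_group :: "nat set \<Rightarrow> ('g, 'm) monoid_scheme \<Rightarrow> 'g topology \<Rightarrow> bool" where
  "pro_group \<pi> G X \<longleftrightarrow>
     profinite_group G X \<and>
     (\<forall>N. N \<lhd> G \<and> openin X N \<and> finite (carrier (G Mod N)) \<longrightarrow>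
        (\<forall>p. prime p \<and> p dvd order (G Mod N) \<longrightarrow> p \<in> \<pi>))"

definition locally_pro_group :: "nat set \<Rightarrow> ('g, 'm) monoid_scheme \<Rightarrow> 'g topology \<Rightarrow> bool" where
  "locally_pro_group \<pi> G X \<longleftrightarrow>
     (\<exists>U. subgroup U G \<and> openin X U \<and> pro_group \<pi> (G\<lparr>carrier := U\<rparr>) (subtopology X U))"

section \<open>Haar measures and unimodularity\<close>

definition radon_measure :: "'g topology \<Rightarrow> 'g measure \<Rightarrow> bool" where
  "radon_measure X M \<longleftrightarrow>
     sets M = sigma_sets (topspace X) {U. openin X U} \<and>
     (\<forall>K. compactin X K \<longrightarrow> emeasure M K < \<infinity>) \<and>
     (\<forall>A\<in>sets M. emeasure M A = (INF U\<in>{U. openin X U \<and> A \<subseteq> U}. emeasure M U)) \<and>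
     (\<forall>U. openin X U \<longrightarrow> emeasure M U = (SUP K\<in>{K. compactin X K \<and> K \<subseteq> U}. emeasure M K))"

definition left_haar_measure ::
    "('g, 'm) monoid_scheme \<Rightarrow> 'g topology \<Rightarrow> 'g measure \<Rightarrow> bool" where
  "left_haar_measure G X M \<longleftrightarrow>
     radon_measure X M \<and> emeasure M (space M) \<noteq> 0 \<and>
     (\<forall>g\<in>carrier G. \<forall>A\<in>sets M. emeasure M (g <#\<^bsub>G\<^esub> A) = emeasure M A)"

definition right_haar_measure ::
    "('g, 'm) monoid_scheme \<Rightarrow> 'g topology \<Rightarrow> 'g measure \<Rightarrow> bool" where
  "right_haar_measure G X M \<longleftrightarrow>
     radon_measure X M \<and> emeasure M (space M) \<noteq> 0 \<and>
     (\<forall>g\<in>carrier G. \<forall>A\<in>sets M. emeasure M (A #>\<^bsub>G\<^esub> g) = emeasure M A)"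

text \<open>
  Unimodularity of a locally compact group: by existence and uniqueness of Haar measure it does
  not matter whether some or every left Haar measure is required to be a right Haar measure.
\<close>

definition unimodular_group :: "('g, 'm) monoid_scheme \<Rightarrow> 'g topology \<Rightarrow> bool" where
  "unimodular_group G X \<longleftrightarrow> (\<exists>M. left_haar_measure G X M \<and> right_haar_measure G X M)"

section \<open>The Chabauty space of closed subgroups\<close>

definition closed_subgroups :: "('g, 'm) monoid_scheme \<Rightarrow> 'g topology \<Rightarrow> 'g set set" where
  "closed_subgroups G X = {H. subgroup H G \<and> closedin X H}"

definition chabauty_nhd ::
    "('g, 'm) monoid_scheme \<Rightarrow> 'g topology \<Rightarrow> 'g set \<Rightarrow> 'g set \<Rightarrow> 'g set \<Rightarrow> 'g set set" where
  "chabauty_nhd G X H K U =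
     {J \<in> closed_subgroups G X. J \<inter> K \<subseteq> H <#>\<^bsub>G\<^esub> U \<and> H \<inter> K \<subseteq> J <#>\<^bsub>G\<^esub> U}"

definition chabauty_topology :: "('g, 'm) monoid_scheme \<Rightarrow> 'g topology \<Rightarrow> 'g set topology" where
  "chabauty_topology G X = topology (\<lambda>\<O>. \<O> \<subseteq> closed_subgroups G X \<and>
     (\<forall>H\<in>\<O>. \<exists>K U. compactin X K \<and> openin X U \<and> \<one>\<^bsub>G\<^esub> \<in> U \<and> chabauty_nhd G X H K U \<subseteq> \<O>))"

lemma chabauty_nhd_mono:
  assumes "K \<subseteq> K'" "U' \<subseteq> U"
  shows "chabauty_nhd G X H K' U' \<subseteq> chabauty_nhd G X H K U"
proof -
  have "A <#>\<^bsub>G\<^esub> U' \<subseteq> A <#>\<^bsub>G\<^esub> U" for A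
    using assms(2) by (auto simp: set_mult_def)
  then show ?thesis
    using assms(1) unfolding chabauty_nhd_def by blast
qed

lemma openin_chabauty_topology:
  "openin (chabauty_topology G X) \<O> \<longleftrightarrow> \<O> \<subseteq> closed_subgroups G X \<and>
     (\<forall>H\<in>\<O>. \<exists>K U. compactin X K \<and> openin X U \<and> \<one>\<^bsub>G\<^esub> \<in> U \<and> chabauty_nhd G X H K U \<subseteq> \<O>)"
proof -
  define P where "P = (\<lambda>H \<O>. \<exists>K U. compactin X K \<and> openin X U \<and> \<one>\<^bsub>G\<^esub> \<in> U \<and>
    chabauty_nhd G X H K U \<subseteq> \<O>)"
  define Q where "Q = (\<lambda>\<O>. \<O> \<subseteq> closed_subgroups G X \<and> (\<forall>H\<in>\<O>. P H \<O>))"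
  have PI: "P H \<O>"
    if "compactin X K" "openin X U" "\<one>\<^bsub>G\<^esub> \<in> U" "chabauty_nhd G X H K U \<subseteq> \<O>" for H \<O> K U
    unfolding P_def using that by (intro exI conjI)
  have mono: "P H \<B>" if A: "P H \<A>" and "\<A> \<subseteq> \<B>" for H \<A> \<B>
  proof -
    obtain K U where 1: "compactin X K" "openin X U" "\<one>\<^bsub>G\<^esub> \<in> U" "chabauty_nhd G X H K U \<subseteq> \<A>"
      using A unfolding P_def by (elim exE conjE)
    show ?thesis
      by (rule PI[OF 1(1-3) subset_trans[OF 1(4) that(2)]])
  qed
  have inter: "P H (\<A> \<inter> \<B>)" if A: "P H \<A>" and B: "P H \<B>" for H \<A> \<B>
  proof -
    obtain K U where 1: "compactin X K" "openin X U" "\<one>\<^bsub>G\<^esub> \<in> U" "chabauty_nhd G X H K U \<subseteq> \<A>"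
      using A unfolding P_def by (elim exE conjE)
    obtain L V where 2: "compactin X L" "openin X V" "\<one>\<^bsub>G\<^esub> \<in> V" "chabauty_nhd G X H L V \<subseteq> \<B>"
      using B unfolding P_def by (elim exE conjE)
    have "chabauty_nhd G X H (K \<union> L) (U \<inter> V) \<subseteq> \<A>"
      by (rule subset_trans[OF chabauty_nhd_mono 1(4)]) simp_all
    moreover have "chabauty_nhd G X H (K \<union> L) (U \<inter> V) \<subseteq> \<B>"
      by (rule subset_trans[OF chabauty_nhd_mono 2(4)]) simp_all
    ultimately have sub: "chabauty_nhd G X H (K \<union> L) (U \<inter> V) \<subseteq> \<A> \<inter> \<B>"
      by (rule Int_greatest)
    show ?thesis
      by (rule PI[OF compactin_Un[OF 1(1) 2(1)] openin_Int[OF 1(2) 2(2)] IntI[OF 1(3) 2(3)] sub])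
  qed
  have "istopology Q"
    unfolding istopology_def
  proof (intro conjI allI impI)
    fix \<A> \<B> assume "Q \<A>" "Q \<B>"
    then show "Q (\<A> \<inter> \<B>)"
      unfolding Q_def using inter by blast
  next
    fix \<K> assume K: "\<forall>\<A>\<in>\<K>. Q \<A>"
    have "P H (\<Union>\<K>)" if "H \<in> \<A>" "\<A> \<in> \<K>" for H \<A>
      by (rule mono[of H \<A>]) (use K that in \<open>auto simp: Q_def\<close>)
    moreover have "\<Union>\<K> \<subseteq> closed_subgroups G X"
      using K unfolding Q_def by blast
    ultimately show "Q (\<Union>\<K>)"
      unfolding Q_def by blast
  qed
  then have "openin (topology Q) = Q"
    by (rule topology_inverse')
  then show ?thesis
    unfolding chabauty_topology_def Q_def P_def by (rule fun_cong)
qed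

lemma topspace_chabauty_topology:
  assumes "topological_group G X"
  shows "topspace (chabauty_topology G X) = closed_subgroups G X"
proof -
  have "group G" "topspace X = carrier G"
    using assms by (auto simp: topological_group_def)
  then have one: "\<one>\<^bsub>G\<^esub> \<in> topspace X"
    by (simp add: group.is_monoid)
  have "chabauty_nhd G X H {} (topspace X) \<subseteq> closed_subgroups G X" for H
    unfolding chabauty_nhd_def by simp
  with one have "openin (chabauty_topology G X) (closed_subgroups G X)"
    unfolding openin_chabauty_topology
    by (intro conjI ballI subset_refl exI[of _ "{}"] exI[of _ "topspace X"]) simp_all
  then have "closed_subgroups G X \<subseteq> topspace (chabauty_topology G X)"
    by (rule openin_subset)
  moreover have "topspace (chabauty_topology G X) \<subseteq> closed_subgroups G X"
    using openin_topspace[of "chabauty_topology G X"] unfolding openin_chabauty_topology by simp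
  ultimately show ?thesis by simp
qed

section \<open>Trees and their automorphism groups\<close>

text \<open>
  An undirected simple graph is a vertex set \<open>V\<close> with a symmetric irreflexive adjacency
  relation \<open>E\<close>; every edge occurs in \<open>E\<close> in both orientations.
\<close>

definition simple_graph :: "'v set \<Rightarrow> ('v \<times> 'v) set \<Rightarrow> bool" where
  "simple_graph V E \<longleftrightarrow> E \<subseteq> V \<times> V \<and> sym E \<and> irrefl E"

definition graph_connected :: "'v set \<Rightarrow> ('v \<times> 'v) set \<Rightarrow> bool" where
  "graph_connected V E \<longleftrightarrow> V \<noteq> {} \<and> (\<forall>x\<in>V. \<forall>y\<in>V. (x, y) \<in> E\<^sup>*)"

definition graph_cycle :: "('v \<times> 'v) set \<Rightarrow> 'v list \<Rightarrow> bool" where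
  "graph_cycle E xs \<longleftrightarrow>
     length xs \<ge> 3 \<and> distinct xs \<and>
     (\<forall>i. Suc i < length xs \<longrightarrow> (xs ! i, xs ! Suc i) \<in> E) \<and> (last xs, hd xs) \<in> E"

definition tree :: "'v set \<Rightarrow> ('v \<times> 'v) set \<Rightarrow> bool" where
  "tree V E \<longleftrightarrow> simple_graph V E \<and> graph_connected V E \<and> (\<nexists>xs. graph_cycle E xs)"

definition locally_finite :: "'v set \<Rightarrow> ('v \<times> 'v) set \<Rightarrow> bool" where
  "locally_finite V E \<longleftrightarrow> (\<forall>v\<in>V. finite (E `` {v}))"

definition vertex_degree :: "('v \<times> 'v) set \<Rightarrow> 'v \<Rightarrow> nat" where
  "vertex_degree E v = card (E `` {v})"

definition graph_aut :: "'v set \<Rightarrow> ('v \<times> 'v) set \<Rightarrow> ('v \<Rightarrow> 'v) monoid" where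
  "graph_aut V E =
     BijGroup V \<lparr>carrier := {f \<in> Bij V. \<forall>x\<in>V. \<forall>y\<in>V. (f x, f y) \<in> E \<longleftrightarrow> (x, y) \<in> E}\<rparr>"

definition graph_aut_topology :: "'v set \<Rightarrow> ('v \<times> 'v) set \<Rightarrow> ('v \<Rightarrow> 'v) topology" where
  "graph_aut_topology V E =
     subtopology (product_topology (\<lambda>_. discrete_topology V) V) (carrier (graph_aut V E))"

definition vertex_orbits :: "'v set \<Rightarrow> ('v \<times> 'v) set \<Rightarrow> ('v \<Rightarrow> 'v) set \<Rightarrow> 'v set set" where
  "vertex_orbits V E H = orbits (graph_aut V E\<lparr>carrier := H\<rparr>) V (\<lambda>g. g)"

definition unimodular_subgroups ::
    "'v set \<Rightarrow> ('v \<times> 'v) set \<Rightarrow> real \<Rightarrow> ('v \<Rightarrow> 'v) set set" where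
  "unimodular_subgroups V E C =
     {H \<in> closed_subgroups (graph_aut V E) (graph_aut_topology V E).
        unimodular_group (graph_aut V E\<lparr>carrier := H\<rparr>) (subtopology (graph_aut_topology V E) H) \<and>
        finite (vertex_orbits V E H) \<and> real (card (vertex_orbits V E H)) \<le> C}"

definition unimodular_subgroup_space ::
    "'v set \<Rightarrow> ('v \<times> 'v) set \<Rightarrow> real \<Rightarrow> ('v \<Rightarrow> 'v) set topology" where
  "unimodular_subgroup_space V E C =
     subtopology (chabauty_topology (graph_aut V E) (graph_aut_topology V E))
       (unimodular_subgroups V E C)"

end

theory Submission
  imports Defs "HOL-Algebra.Sylow" "HOL-Algebra.Multiplicative_Group"
begin

text \<open>If \<open>H\<close> is locally pro-\<open>\<pi>\<close>, then for \<open>r\<close> large the fixer in \<open>H\<close> of the \<open>r\<close>-ball around \<open>w\<close>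
  induces a \<open>\<pi>\<close>-group on the \<open>(r + 1)\<close>-ball, and \<open>r\<close> can be chosen uniformly for the finitely many
  \<open>w\<close> in a ball of radius \<open>C\<close>. This condition only concerns finitely many vertices, so it is
  inherited by every closed subgroup \<open>J\<close> near \<open>H\<close>. If \<open>J\<close> has at most \<open>C\<close> vertex orbits, then every
  orbit meets the ball of radius \<open>C\<close>, so by conjugation the condition holds for \<open>J\<close> at every vertex.
  An element of \<open>J\<close> fixing an \<open>r\<close>-ball and acting with \<open>p\<close>-power order on a larger ball, where
  \<open>p \<notin> \<pi>\<close>, then fixes bigger and bigger balls one step at a time; hence the fixer of an \<open>r\<close>-ball in
  \<open>J\<close> has no finite continuous quotient of order divisible by \<open>p\<close>. The discrete case is
  \<open>\<pi> = {}\<close>.\<close>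

section \<open>Elements of prime order and coprime exponents\<close>

text \<open>Sylow's theorem is applied with the power \<open>p ^ 1\<close>, which need not be the
  full power of \<open>p\<close> in the order. In the resulting subgroup of order \<open>p\<close>
  any element other than \<open>\<one>\<close> will do.\<close>

lemma (in group) cauchy_prime_order:
  assumes "finite (carrier G)" "prime p" "p dvd order G"
  obtains c where "c \<in> carrier G" "c \<noteq> \<one>" "c [^] p = \<one>"
proof -
  obtain m where "order G = p ^ 1 * m"
    using assms(3) by auto
  from sylow_thm[OF assms(2) is_group this assms(1)] obtain H where H: "subgroup H G" "card H = p"
    by auto
  interpret H: group "G\<lparr>carrier := H\<rparr>"
    by (rule subgroup_imp_group[OF H(1)])
  have "p > 1"
    using assms(2) prime_gt_1_nat by blast
  then have "H \<noteq> {\<one>}" "\<one> \<in> H"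
    using H subgroup.one_closed by auto
  then obtain c where c: "c \<in> H" "c \<noteq> \<one>"
    by blast
  have "c [^]\<^bsub>G\<lparr>carrier := H\<rparr>\<^esub> p = \<one>"
    using H.pow_order_eq_1[of c] c H(2) by (simp add: order_def)
  then have "c [^] p = \<one>"
    by (simp add: nat_pow_def)
  moreover have "c \<in> carrier G"
    using c H(1) subgroup.mem_carrier by fast
  ultimately show thesis
    using that c by blast
qed

lemma (in group) eq_one_if_coprime_powers:
  fixes m n :: nat
  assumes "x \<in> carrier G" "x [^] m = \<one>" "x [^] n = \<one>" "coprime m n"
  shows "x = \<one>"
proof -
  have "ord x dvd m" "ord x dvd n"
    using assms pow_eq_id by auto
  then have "ord x = 1"
    using assms(4) coprime_common_divisor_nat by blast
  then show ?thesis
    using assms(1) ord_eq_1 by blast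
qed

lemma funpow_mult_fixed:
  assumes "(f ^^ m) x = x"
  shows "(f ^^ (m * k)) x = x"
proof -
  have "((f ^^ m) ^^ k) x = x"
    by (induction k) (use assms in auto)
  then show ?thesis
    by (simp add: funpow_mult)
qed

text \<open>The map \<open>f\<close> need not be invertible, so Bezout's identity is used in the
  subtraction-free form \<open>p * a = m * b + 1\<close>: the left side fixes \<open>x\<close>, and
  the right side sends \<open>x\<close> to \<open>f x\<close>.\<close>

lemma fixed_if_coprime_funpow_fixed:
  fixes p m :: nat
  assumes "(f ^^ p) x = x" "(f ^^ m) x = x" "coprime p m"
  shows "f x = x"
\<comment> \<open>\<open>bezout_nat\<close> wants a nonzero first argument. If \<open>p = 0\<close>,
  coprimality forces \<open>m = 1\<close>.\<close>
proof (cases "p = 0")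
  case True
  then show ?thesis
    using assms by simp
next
  case False
  then obtain a b where "p * a = m * b + 1"
    using bezout_nat[of p m] assms(3) by auto
  then have "x = (f ^^ (m * b + 1)) x"
    using funpow_mult_fixed[OF assms(1), of a] by simp
  then show ?thesis
    using funpow_mult_fixed[OF assms(2), of b] by simp
qed

section \<open>Balls and automorphisms\<close>

text \<open>The reflexive closure lets a walk stand still, so exactly \<open>n\<close> steps reach
  every vertex at distance at most \<open>n\<close>.\<close>

definition gball :: "('v \<times> 'v) set \<Rightarrow> nat \<Rightarrow> 'v \<Rightarrow> 'v set" where
  "gball E n v = ((E\<^sup>=) ^^ n) `` {v}"

lemma gball_iff: "x \<in> gball E n v \<longleftrightarrow> (v, x) \<in> (E\<^sup>=) ^^ n"
  by (simp add: gball_def)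

lemma gball_self: "v \<in> gball E n v"
  unfolding gball_iff by (induction n) auto

lemma gball_Suc: "x \<in> gball E (Suc n) v \<longleftrightarrow> (\<exists>w. w \<in> gball E n v \<and> (w = x \<or> (w, x) \<in> E))"
  unfolding gball_iff relpow.simps relcomp_unfold by blast

lemma gball_add: "x \<in> gball E (m + n) v \<longleftrightarrow> (\<exists>w. w \<in> gball E m v \<and> x \<in> gball E n w)"
  by (auto simp: gball_iff relpow_add)

lemma gball_trans: "w \<in> gball E m v \<Longrightarrow> x \<in> gball E n w \<Longrightarrow> x \<in> gball E (m + n) v"
  using gball_add by metis

lemma gball_mono:
  assumes "m \<le> n"
  shows "gball E m v \<subseteq> gball E n v"
proof
  fix x assume "x \<in> gball E m v"
  then have "x \<in> gball E (m + (n - m)) v"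
    using gball_self gball_trans by metis
  then show "x \<in> gball E n v"
    using assms by simp
qed

lemma gball_subset_gball: "w \<in> gball E m v \<Longrightarrow> m + n \<le> k \<Longrightarrow> gball E n w \<subseteq> gball E k v"
  using gball_trans gball_mono by fast

lemma rtrancl_imp_gball: "(v, x) \<in> E\<^sup>* \<Longrightarrow> \<exists>n. x \<in> gball E n v"
  unfolding gball_iff by (metis rtrancl_reflcl rtrancl_imp_relpow)

definition fixer :: "('v \<Rightarrow> 'v) set \<Rightarrow> 'v set \<Rightarrow> ('v \<Rightarrow> 'v) set" where
  "fixer H S = {g \<in> H. \<forall>x\<in>S. g x = x}"

text \<open>By Cauchy's theorem this says that the finite permutation group which the pointwise fixer of
  the \<open>r\<close>-ball around \<open>w\<close> induces on the \<open>(r + 1)\<close>-ball is a \<open>\<pi>\<close>-group. The form without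
  quotients transfers along Chabauty approximations.\<close>

definition pi_rigid :: "('v \<times> 'v) set \<Rightarrow> nat set \<Rightarrow> ('v \<Rightarrow> 'v) set \<Rightarrow> 'v \<Rightarrow> nat \<Rightarrow> bool" where
  "pi_rigid E \<pi> J w r \<longleftrightarrow>
     (\<forall>g\<in>fixer J (gball E r w). \<forall>p. prime p \<and> p \<notin> \<pi> \<and> (\<forall>x\<in>gball E (Suc r) w. (g ^^ p) x = x) \<longrightarrow>
        (\<forall>x\<in>gball E (Suc r) w. g x = x))"

locale locally_finite_graph =
  fixes V :: "'v set" and E :: "('v \<times> 'v) set"
  assumes simple: "simple_graph V E"
    and connected: "graph_connected V E"
    and loc_finite: "locally_finite V E"
begin

abbreviation Aut :: "('v \<Rightarrow> 'v) monoid" where "Aut \<equiv> graph_aut V E"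
abbreviation X :: "('v \<Rightarrow> 'v) topology" where "X \<equiv> graph_aut_topology V E"

lemma edge_vertices: "(x, y) \<in> E \<Longrightarrow> x \<in> V \<and> y \<in> V"
  using simple unfolding simple_graph_def by blast

lemma gball_subset_vertices:
  assumes "v \<in> V"
  shows "gball E n v \<subseteq> V"
proof (induction n)
  case 0
  then show ?case using assms by (simp add: gball_def)
next
  case (Suc n)
  show ?case
    by (rule subsetI, unfold gball_Suc) (use Suc edge_vertices in blast)
qed

lemma finite_gball:
  assumes "v \<in> V"
  shows "finite (gball E n v)"
proof (induction n)
  case 0
  then show ?case by (simp add: gball_def)
next
  case (Suc n)
  have "gball E (Suc n) v = (\<Union>w\<in>gball E n v. insert w (E `` {w}))"
    by (auto simp: gball_Suc)
  moreover have "finite (E `` {w})" if "w \<in> gball E n v" for w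
    using that gball_subset_vertices[OF assms, of n] loc_finite
    unfolding locally_finite_def by (meson subsetD)
  ultimately show ?case
    using Suc by simp
qed

lemma finite_subset_gball:
  assumes "v \<in> V" "finite F" "F \<subseteq> V"
  obtains n where "F \<subseteq> gball E n v"
proof -
  have "\<exists>n. x \<in> gball E n v" if "x \<in> F" for x
  proof (rule rtrancl_imp_gball)
    show "(v, x) \<in> E\<^sup>*"
      using connected assms that unfolding graph_connected_def by (meson subsetD)
  qed
  then obtain f where f: "\<And>x. x \<in> F \<Longrightarrow> x \<in> gball E (f x) v"
    by metis
  have "x \<in> gball E (Max (f ` F)) v" if "x \<in> F" for x
  proof -
    have "f x \<le> Max (f ` F)"
      using assms(2) that by simp
    then show ?thesis
      using f[OF that] gball_mono by (meson subsetD)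
  qed
  then show thesis
    using that by (meson subsetI)
qed

section \<open>Automorphisms as extensional bijections of the vertex set\<close>

lemma aut_carrier_iff:
  "g \<in> carrier Aut \<longleftrightarrow> g \<in> extensional V \<and> bij_betw g V V \<and>
     (\<forall>x\<in>V. \<forall>y\<in>V. (g x, g y) \<in> E \<longleftrightarrow> (x, y) \<in> E)"
  by (auto simp: graph_aut_def Bij_def)

lemma subgroup_aut_Bij: "subgroup (carrier Aut) (BijGroup V)"
proof -
  interpret B: group "BijGroup V" by (rule group_BijGroup)
  show ?thesis
  proof (rule B.subgroupI)
    show "carrier Aut \<subseteq> carrier (BijGroup V)"
      by (auto simp: graph_aut_def BijGroup_def)
    have "\<one>\<^bsub>BijGroup V\<^esub> \<in> carrier Aut"
      by (auto simp: graph_aut_def BijGroup_def id_Bij)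
    then show "carrier Aut \<noteq> {}" by auto
  next
    fix g assume g: "g \<in> carrier Aut"
    then have B: "g \<in> Bij V" by (simp add: graph_aut_def)
    then have b: "bij_betw g V V" by (simp add: Bij_def)
    have "(inv_into V g x, inv_into V g y) \<in> E \<longleftrightarrow> (x, y) \<in> E" if "x \<in> V" "y \<in> V" for x y
      using g b that unfolding aut_carrier_iff
      by (metis bij_betw_def f_inv_into_f inv_into_into)
    then show "inv\<^bsub>BijGroup V\<^esub> g \<in> carrier Aut"
      using B by (simp add: inv_BijGroup graph_aut_def restrict_inv_into_Bij)
  next
    fix g h assume g: "g \<in> carrier Aut" and h: "h \<in> carrier Aut"
    then have B: "g \<in> Bij V" "h \<in> Bij V" by (simp_all add: graph_aut_def)
    have "h x \<in> V" if "x \<in> V" for x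
      using B that Bij_imp_funcset by fast
    then show "g \<otimes>\<^bsub>BijGroup V\<^esub> h \<in> carrier Aut"
      using B g h compose_Bij[OF B] by (simp add: BijGroup_def graph_aut_def compose_def)
  qed
qed

sublocale Aut: group Aut
proof -
  have "Aut = BijGroup V\<lparr>carrier := carrier Aut\<rparr>"
    by (simp add: graph_aut_def)
  then show "group Aut"
    using group.subgroup_imp_group[OF group_BijGroup subgroup_aut_Bij] by metis
qed

lemma aut_in_vertices: "g \<in> carrier Aut \<Longrightarrow> x \<in> V \<Longrightarrow> g x \<in> V"
  by (meson aut_carrier_iff bij_betwE)

lemma mult_aut_apply:
  "g \<in> carrier Aut \<Longrightarrow> h \<in> carrier Aut \<Longrightarrow> x \<in> V \<Longrightarrow> (g \<otimes>\<^bsub>Aut\<^esub> h) x = g (h x)"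
  by (simp add: graph_aut_def BijGroup_def compose_def)

lemma one_aut_apply: "x \<in> V \<Longrightarrow> \<one>\<^bsub>Aut\<^esub> x = x"
  by (simp add: graph_aut_def BijGroup_def)

lemma inv_aut_apply: "g \<in> carrier Aut \<Longrightarrow> x \<in> V \<Longrightarrow> (inv\<^bsub>Aut\<^esub> g) (g x) = x"
  using mult_aut_apply[of "inv\<^bsub>Aut\<^esub> g" g x] by (simp add: one_aut_apply)

lemma aut_inv_apply: "g \<in> carrier Aut \<Longrightarrow> x \<in> V \<Longrightarrow> g ((inv\<^bsub>Aut\<^esub> g) x) = x"
  using mult_aut_apply[of g "inv\<^bsub>Aut\<^esub> g" x] by (simp add: one_aut_apply)

lemma aut_eqI:
  assumes "g \<in> carrier Aut" "h \<in> carrier Aut" "\<And>x. x \<in> V \<Longrightarrow> g x = h x"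
  shows "g = h"
  using assms unfolding aut_carrier_iff by (meson extensionalityI)

text \<open>Bridge between powers in the group and iteration of the function. It is restricted to
  \<open>V\<close> because automorphisms are \<open>undefined\<close> elsewhere, whereas
  \<open>g ^^ 0\<close> is the identity everywhere.\<close>

lemma pow_aut_apply:
  fixes n :: nat
  assumes "g \<in> carrier Aut"
  shows "x \<in> V \<Longrightarrow> (g [^]\<^bsub>Aut\<^esub> n) x = (g ^^ n) x"
proof (induction n arbitrary: x)
  case 0
  then show ?case by (simp add: one_aut_apply)
next
  case (Suc n)
  then show ?case
    using assms by (simp add: mult_aut_apply aut_in_vertices funpow_swap1)
qed

lemma aut_gball:
  assumes "g \<in> carrier Aut" "v \<in> V" "x \<in> gball E n v"
  shows "g x \<in> gball E n (g v)"
  using assms(3)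
proof (induction n arbitrary: x)
  case 0
  then show ?case by (simp add: gball_def)
next
  case (Suc n)
  then obtain w where w: "w \<in> gball E n v" "w = x \<or> (w, x) \<in> E"
    unfolding gball_Suc by blast
  have "g w \<in> gball E n (g v)"
    by (rule Suc.IH[OF w(1)])
  moreover have "g w = g x \<or> (g w, g x) \<in> E"
    using w(2) assms(1) edge_vertices[of w x] unfolding aut_carrier_iff by metis
  ultimately show ?case
    unfolding gball_Suc by blast
qed

lemma subgroup_fixer:
  assumes "subgroup H Aut" "S \<subseteq> V"
  shows "subgroup (fixer H S) Aut"
proof (rule Aut.subgroupI)
  have H: "H \<subseteq> carrier Aut" using assms(1) subgroup.subset by blast
  show "fixer H S \<subseteq> carrier Aut" using H by (auto simp: fixer_def)
  have "\<one>\<^bsub>Aut\<^esub> \<in> fixer H S"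
    using assms subgroup.one_closed one_aut_apply unfolding fixer_def by fast
  then show "fixer H S \<noteq> {}" by blast
  show "inv\<^bsub>Aut\<^esub> g \<in> fixer H S" if "g \<in> fixer H S" for g
    using that assms H subgroup.m_inv_closed[OF assms(1)] inv_aut_apply unfolding fixer_def
    by (smt (verit) mem_Collect_eq subset_iff)
  show "g \<otimes>\<^bsub>Aut\<^esub> h \<in> fixer H S" if "g \<in> fixer H S" "h \<in> fixer H S" for g h
  proof -
    have "g \<in> H" "h \<in> H" using that by (auto simp: fixer_def)
    then have "g \<otimes>\<^bsub>Aut\<^esub> h \<in> H" "g \<in> carrier Aut" "h \<in> carrier Aut"
      using subgroup.m_closed[OF assms(1)] H by auto
    then show ?thesis
      using that assms(2) by (auto simp: fixer_def mult_aut_apply subset_iff)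
  qed
qed

section \<open>The topology of pointwise convergence\<close>

lemma aut_PiE: "g \<in> carrier Aut \<Longrightarrow> g \<in> (\<Pi>\<^sub>E x\<in>V. V)"
  using aut_in_vertices[of g] unfolding aut_carrier_iff by (simp add: PiE_iff)

text \<open>A basic box of the product restricts finitely many coordinates, and agreement with
  \<open>g\<close> on these keeps a map in the box. Conversely, singletons are open in the discrete
  factors.\<close>

lemma openin_aut_iff:
  "openin X S \<longleftrightarrow> S \<subseteq> carrier Aut \<and>
     (\<forall>g\<in>S. \<exists>F. finite F \<and> F \<subseteq> V \<and> (\<forall>h\<in>carrier Aut. (\<forall>x\<in>F. h x = g x) \<longrightarrow> h \<in> S))"
proof -
  show ?thesis
  proof (intro iffI conjI ballI)
    assume "openin X S"
    then obtain T where T: "openin (product_topology (\<lambda>_. discrete_topology V) V) T"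
      and S: "S = T \<inter> carrier Aut"
      unfolding graph_aut_topology_def openin_subtopology by blast
    show "S \<subseteq> carrier Aut" using S by blast
    fix g assume g: "g \<in> S"
    then obtain U where U: "finite {x \<in> V. U x \<noteq> V}" "g \<in> Pi\<^sub>E V U" "Pi\<^sub>E V U \<subseteq> T"
      using T S unfolding openin_product_topology_alt topspace_discrete_topology by (metis IntD1)
    have "h \<in> S" if "h \<in> carrier Aut" "\<forall>x\<in>{x \<in> V. U x \<noteq> V}. h x = g x" for h
    proof -
      have "h \<in> Pi\<^sub>E V U"
      proof (rule PiE_I)
        show "h x \<in> U x" if "x \<in> V" for x
        proof (cases "U x = V")
          case True
          then show ?thesis using aut_in_vertices[OF \<open>h \<in> carrier Aut\<close> that] by simp
        next
          case False
          then have "h x = g x"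
            using \<open>\<forall>x\<in>{x \<in> V. U x \<noteq> V}. h x = g x\<close> that by simp
          then show ?thesis using PiE_mem[OF U(2) that] by simp
        qed
        show "h x = undefined" if "x \<notin> V" for x
          by (rule PiE_arb[OF aut_PiE[OF \<open>h \<in> carrier Aut\<close>] that])
      qed
      then show ?thesis using that U(3) S by blast
    qed
    then show "\<exists>F. finite F \<and> F \<subseteq> V \<and> (\<forall>h\<in>carrier Aut. (\<forall>x\<in>F. h x = g x) \<longrightarrow> h \<in> S)"
      using U(1) by (intro exI[of _ "{x \<in> V. U x \<noteq> V}"]) auto
  next
    assume asm: "S \<subseteq> carrier Aut \<and>
     (\<forall>g\<in>S. \<exists>F. finite F \<and> F \<subseteq> V \<and> (\<forall>h\<in>carrier Aut. (\<forall>x\<in>F. h x = g x) \<longrightarrow> h \<in> S))"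
    show "openin X S"
    proof (subst openin_subopen, intro ballI)
      fix g assume g: "g \<in> S"
      then obtain F where F: "finite F" "F \<subseteq> V" "\<forall>h\<in>carrier Aut. (\<forall>x\<in>F. h x = g x) \<longrightarrow> h \<in> S"
        using asm by blast
      \<comment> \<open>The box consisting of the maps that agree with \<open>g\<close> on
        \<open>F\<close>.\<close>
      define U where "U = (\<lambda>x. if x \<in> F then {g x} else V)"
      have gA: "g \<in> carrier Aut" using g asm by blast
      have "openin (product_topology (\<lambda>_. discrete_topology V) V) (Pi\<^sub>E V U)"
        unfolding openin_PiE_gen
      proof (intro disjI2 conjI ballI)
        show "finite {i \<in> V. U i \<noteq> topspace (discrete_topology V)}"
          by (rule finite_subset[OF _ F(1)]) (auto simp: U_def)
        show "openin (discrete_topology V) (U i)" if "i \<in> V" for i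
          using aut_in_vertices[OF gA that] by (simp add: U_def)
      qed
      then have "openin X (Pi\<^sub>E V U \<inter> carrier Aut)"
        unfolding graph_aut_topology_def by (rule openin_subtopology_Int)
      moreover have "g \<in> Pi\<^sub>E V U \<inter> carrier Aut"
        using gA aut_PiE[OF gA] by (auto simp: U_def PiE_iff)
      moreover have "Pi\<^sub>E V U \<inter> carrier Aut \<subseteq> S"
        using F by (fastforce simp: U_def PiE_iff)
      ultimately show "\<exists>T. openin X T \<and> g \<in> T \<and> T \<subseteq> S" by blast
    qed
  qed
qed

lemma topspace_aut: "topspace X = carrier Aut"
proof
  show "topspace X \<subseteq> carrier Aut"
    by (simp add: graph_aut_topology_def)
  have "openin X (carrier Aut)"
    unfolding openin_aut_iff by auto
  then show "carrier Aut \<subseteq> topspace X"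
    by (rule openin_subset)
qed

lemma openin_sub_aut_iff:
  assumes "U \<subseteq> carrier Aut"
  shows "openin (subtopology X U) S \<longleftrightarrow> S \<subseteq> U \<and>
     (\<forall>g\<in>S. \<exists>F. finite F \<and> F \<subseteq> V \<and> (\<forall>h\<in>U. (\<forall>x\<in>F. h x = g x) \<longrightarrow> h \<in> S))"
    (is "_ \<longleftrightarrow> ?R")
proof
  assume "openin (subtopology X U) S"
  then obtain T where T: "openin X T" "S = T \<inter> U"
    unfolding openin_subtopology by blast
  show ?R
  proof (intro conjI ballI)
    show "S \<subseteq> U" using T(2) by blast
    fix g assume "g \<in> S"
    then have "g \<in> T" using T(2) by blast
    then obtain F where F: "finite F" "F \<subseteq> V" "\<forall>h\<in>carrier Aut. (\<forall>x\<in>F. h x = g x) \<longrightarrow> h \<in> T"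
      using T(1) unfolding openin_aut_iff by meson
    show "\<exists>F. finite F \<and> F \<subseteq> V \<and> (\<forall>h\<in>U. (\<forall>x\<in>F. h x = g x) \<longrightarrow> h \<in> S)"
      by (intro exI[of _ F] conjI F(1,2) ballI impI) (use F(3) T(2) assms in blast)
  qed
next
  assume R: ?R
  \<comment> \<open>The union of all basic neighborhoods in \<open>Aut\<close> of elements of
    \<open>S\<close> whose trace on \<open>U\<close> lies in \<open>S\<close>; it is an open set
    that cuts \<open>S\<close> out of \<open>U\<close>.\<close>
  define T where "T = {h \<in> carrier Aut. \<exists>g\<in>S. \<exists>F. finite F \<and> F \<subseteq> V \<and> (\<forall>x\<in>F. h x = g x) \<and>
     (\<forall>k\<in>U. (\<forall>x\<in>F. k x = g x) \<longrightarrow> k \<in> S)}"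
  have "openin X T"
    unfolding openin_aut_iff
  proof (intro conjI ballI)
    show "T \<subseteq> carrier Aut" by (auto simp: T_def)
    fix h assume "h \<in> T"
    then obtain g F where "g \<in> S" "finite F" "F \<subseteq> V" "\<forall>x\<in>F. h x = g x"
      "\<forall>k\<in>U. (\<forall>x\<in>F. k x = g x) \<longrightarrow> k \<in> S"
      unfolding T_def by blast
    note F = this
    show "\<exists>F. finite F \<and> F \<subseteq> V \<and> (\<forall>k\<in>carrier Aut. (\<forall>x\<in>F. k x = h x) \<longrightarrow> k \<in> T)"
    proof (intro exI[of _ F] conjI ballI impI F(2,3))
      fix k assume k: "k \<in> carrier Aut" "\<forall>x\<in>F. k x = h x"
      then have "\<forall>x\<in>F. k x = g x" using F(4) by simp
      then show "k \<in> T" unfolding T_def using k(1) F by blast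
    qed
  qed
  moreover have "S = T \<inter> U"
  proof
    show "S \<subseteq> T \<inter> U"
    proof
      fix g assume "g \<in> S"
      then show "g \<in> T \<inter> U"
        using R assms unfolding T_def by blast
    qed
    show "T \<inter> U \<subseteq> S" unfolding T_def by blast
  qed
  ultimately show "openin (subtopology X U) S"
    unfolding openin_subtopology by blast
qed

lemma topspace_sub_aut: "U \<subseteq> carrier Aut \<Longrightarrow> topspace (subtopology X U) = U"
  using topspace_aut by auto

lemma topological_group_sub_aut:
  assumes "subgroup U Aut"
  shows "topological_group (Aut\<lparr>carrier := U\<rparr>) (subtopology X U)"
  unfolding topological_group_def
proof (intro conjI)
  have U: "U \<subseteq> carrier Aut" using assms subgroup.subset by blast
  note op = openin_sub_aut_iff[OF U]
  show "group (Aut\<lparr>carrier := U\<rparr>)"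
    by (rule Aut.subgroup_imp_group[OF assms])
  show "topspace (subtopology X U) = carrier (Aut\<lparr>carrier := U\<rparr>)"
    using topspace_sub_aut[OF U] by simp
  show "continuous_map (prod_topology (subtopology X U) (subtopology X U)) (subtopology X U)
     (\<lambda>(x, y). x \<otimes>\<^bsub>Aut\<lparr>carrier := U\<rparr>\<^esub> y)"
    unfolding continuous_map_def topspace_prod_topology topspace_sub_aut[OF U]
  proof (intro conjI allI impI)
    show "(\<lambda>(x, y). x \<otimes>\<^bsub>Aut\<lparr>carrier := U\<rparr>\<^esub> y) \<in> U \<times> U \<rightarrow> U"
      using subgroup.m_closed[OF assms] by auto
    fix S assume S: "openin (subtopology X U) S"
    show "openin (prod_topology (subtopology X U) (subtopology X U))
      {z \<in> U \<times> U. (case z of (x, y) \<Rightarrow> x \<otimes>\<^bsub>Aut\<lparr>carrier := U\<rparr>\<^esub> y) \<in> S}"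
      unfolding openin_prod_topology_alt
    proof (intro allI impI)
      fix g h
      assume "(g, h) \<in> {z \<in> U \<times> U. (case z of (x, y) \<Rightarrow> x \<otimes>\<^bsub>Aut\<lparr>carrier := U\<rparr>\<^esub> y) \<in> S}"
      then have gh: "g \<in> U" "h \<in> U" "g \<otimes>\<^bsub>Aut\<^esub> h \<in> S" by auto
      then obtain F where F: "finite F" "F \<subseteq> V"
        "\<forall>k\<in>U. (\<forall>x\<in>F. k x = (g \<otimes>\<^bsub>Aut\<^esub> h) x) \<longrightarrow> k \<in> S"
        using S unfolding op by blast
      \<comment> \<open>The value of a product at \<open>x\<close> is the left factor evaluated at
        the image of \<open>x\<close> under the right one. Hence the right factor is controlled on
        \<open>F\<close> and the left one on the image of \<open>F\<close> under
        \<open>h\<close>.\<close>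
      define P where "P = {k \<in> U. \<forall>x\<in>h ` F. k x = g x}"
      define Q where "Q = {k \<in> U. \<forall>x\<in>F. k x = h x}"
      have "openin (subtopology X U) P"
        unfolding op
      proof (intro conjI ballI exI)
        show "h ` F \<subseteq> V" using F(2) gh(2) U aut_in_vertices[of h] by blast
      qed (use F in \<open>auto simp: P_def\<close>)
      moreover have "openin (subtopology X U) Q"
        unfolding op
      proof (intro conjI ballI exI)
        show "F \<subseteq> V" by (rule F)
      qed (use F in \<open>auto simp: Q_def\<close>)
      moreover have "k \<otimes>\<^bsub>Aut\<^esub> l \<in> S" if "k \<in> P" "l \<in> Q" for k l
      proof -
        have kl: "k \<in> U" "l \<in> U" "k \<otimes>\<^bsub>Aut\<^esub> l \<in> U"
          using that subgroup.m_closed[OF assms] by (auto simp: P_def Q_def)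
        have "(k \<otimes>\<^bsub>Aut\<^esub> l) x = (g \<otimes>\<^bsub>Aut\<^esub> h) x" if "x \<in> F" for x
          using \<open>k \<in> P\<close> \<open>l \<in> Q\<close> kl gh U F(2) that
          by (auto simp: P_def Q_def mult_aut_apply subset_iff)
        then show ?thesis using F(3) kl(3) by blast
      qed
      ultimately show "\<exists>P Q. openin (subtopology X U) P \<and> openin (subtopology X U) Q \<and> g \<in> P \<and>
        h \<in> Q \<and> P \<times> Q \<subseteq> {z \<in> U \<times> U. (case z of (x, y) \<Rightarrow> x \<otimes>\<^bsub>Aut\<lparr>carrier := U\<rparr>\<^esub> y) \<in> S}"
        using gh by (intro exI[of _ P] exI[of _ Q]) (auto simp: P_def Q_def)
    qed
  qed
  have inv: "inv\<^bsub>Aut\<lparr>carrier := U\<rparr>\<^esub> g = inv\<^bsub>Aut\<^esub> g" if "g \<in> U" for g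
    using Aut.m_inv_consistent[OF assms that] .
  show "continuous_map (subtopology X U) (subtopology X U) (\<lambda>x. inv\<^bsub>Aut\<lparr>carrier := U\<rparr>\<^esub> x)"
    unfolding continuous_map_def topspace_sub_aut[OF U]
  proof (intro conjI allI impI)
    show "(\<lambda>x. inv\<^bsub>Aut\<lparr>carrier := U\<rparr>\<^esub> x) \<in> U \<rightarrow> U"
      using subgroup.m_inv_closed[OF assms] inv by auto
    fix S assume S: "openin (subtopology X U) S"
    show "openin (subtopology X U) {g \<in> U. inv\<^bsub>Aut\<lparr>carrier := U\<rparr>\<^esub> g \<in> S}"
      unfolding op
    proof (intro conjI ballI)
      fix g assume "g \<in> {g \<in> U. inv\<^bsub>Aut\<lparr>carrier := U\<rparr>\<^esub> g \<in> S}"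
      then have g: "g \<in> U" "inv\<^bsub>Aut\<^esub> g \<in> S" "g \<in> carrier Aut" using inv U by auto
      then obtain F where F: "finite F" "F \<subseteq> V"
        "\<forall>k\<in>U. (\<forall>x\<in>F. k x = (inv\<^bsub>Aut\<^esub> g) x) \<longrightarrow> k \<in> S"
        using S unfolding op by blast
      show "\<exists>F. finite F \<and> F \<subseteq> V \<and> (\<forall>h\<in>U. (\<forall>x\<in>F. h x = g x) \<longrightarrow>
         h \<in> {g \<in> U. inv\<^bsub>Aut\<lparr>carrier := U\<rparr>\<^esub> g \<in> S})"
      proof (intro exI conjI ballI impI)
        \<comment> \<open>If \<open>h\<close> agrees with \<open>g\<close> on the preimage of
          \<open>F\<close> under \<open>g\<close>, then the inverses of \<open>h\<close> and
          \<open>g\<close> agree on \<open>F\<close>.\<close>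
        show "finite ((inv\<^bsub>Aut\<^esub> g) ` F)" using F by simp
        show "(inv\<^bsub>Aut\<^esub> g) ` F \<subseteq> V" using F g aut_in_vertices by auto
        fix h assume h: "h \<in> U" "\<forall>x\<in>(inv\<^bsub>Aut\<^esub> g) ` F. h x = g x"
        have hA: "h \<in> carrier Aut" using h U by blast
        have "(inv\<^bsub>Aut\<^esub> h) x = (inv\<^bsub>Aut\<^esub> g) x" if x: "x \<in> F" for x
        proof -
          have xV: "x \<in> V" using x F by blast
          then have "h ((inv\<^bsub>Aut\<^esub> g) x) = x"
            using h(2) x aut_inv_apply[OF g(3)] by simp
          then show ?thesis
            using inv_aut_apply[OF hA, of "(inv\<^bsub>Aut\<^esub> g) x"] aut_in_vertices xV g(3) by simp
        qed
        then have "inv\<^bsub>Aut\<^esub> h \<in> S"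
          using F(3) h subgroup.m_inv_closed[OF assms] by blast
        then show "h \<in> {g \<in> U. inv\<^bsub>Aut\<lparr>carrier := U\<rparr>\<^esub> g \<in> S}"
          using h inv by simp
      qed
    qed auto
  qed
qed

lemma Hausdorff_aut: "Hausdorff_space X"
  unfolding graph_aut_topology_def
  by (intro Hausdorff_space_subtopology) (simp add: Hausdorff_space_product_topology)

lemma totally_disconnected_sub_aut:
  assumes U: "U \<subseteq> carrier Aut"
  shows "totally_disconnected_space (subtopology X U)"
  unfolding totally_disconnected_space_def
proof (intro allI impI)
  fix S assume S: "connectedin (subtopology X U) S"
  note op = openin_sub_aut_iff[OF U]
  have SU: "S \<subseteq> U"
    using connectedin_subset_topspace[OF S] topspace_sub_aut[OF U] by simp
  have eq: "g = h" if "g \<in> S" "h \<in> S" for g h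
  proof (rule ccontr)
    assume "g \<noteq> h"
    moreover have "g \<in> carrier Aut" "h \<in> carrier Aut"
      using that SU U by auto
    ultimately obtain x where x: "x \<in> V" "g x \<noteq> h x"
      using aut_eqI[of g h] by blast
    \<comment> \<open>The value at a single vertex \<open>x\<close> splits \<open>U\<close> into two
      disjoint open sets, one containing \<open>g\<close> and the other \<open>h\<close>.\<close>
    define P where "P = {k \<in> U. k x = g x}"
    define Q where "Q = {k \<in> U. k x \<noteq> g x}"
    have "openin (subtopology X U) P" "openin (subtopology X U) Q"
      unfolding op using x(1) by (auto simp: P_def Q_def intro!: exI[of _ "{x}"])
    moreover have "S \<subseteq> P \<union> Q" "P \<inter> Q \<inter> S = {}" "P \<inter> S \<noteq> {}" "Q \<inter> S \<noteq> {}"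
      using SU that x by (auto simp: P_def Q_def)
    ultimately show False
      using S unfolding connectedin by blast
  qed
  show "\<exists>a. S \<subseteq> {a}"
    using eq by (metis empty_subsetI insertI1 singletonD subsetI ex_in_conv)
qed

section \<open>Compactness of vertex stabilizers\<close>

text \<open>An injective self-map of a finite ball is onto, and the balls around \<open>w\<close>
  exhaust \<open>V\<close>. This recovers surjectivity, which is not directly a condition on
  finitely many values of \<open>f\<close>.\<close>

lemma inj_on_fixing_bij:
  assumes "f \<in> V \<rightarrow> V" "inj_on f V" "w \<in> V" "\<And>n. f ` gball E n w \<subseteq> gball E n w"
  shows "bij_betw f V V"
proof -
  have "y \<in> f ` V" if y: "y \<in> V" for y
  proof -
    obtain n where n: "y \<in> gball E n w"
      using finite_subset_gball[of w "{y}"] assms(3) y by auto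
    have "f ` gball E n w = gball E n w"
      by (rule endo_inj_surj[OF finite_gball[OF assms(3)] assms(4)
            inj_on_subset[OF assms(2) gball_subset_vertices[OF assms(3)]]])
    then show ?thesis
      using n gball_subset_vertices[OF assms(3)] by blast
  qed
  then show ?thesis
    using assms(1,2) by (auto simp: bij_betw_def)
qed

text \<open>By Tychonoff: an automorphism fixing \<open>w\<close> preserves the finite balls around
  \<open>w\<close>, so the stabilizer lies in a product of finite sets, and it is closed in the full
  product.\<close>

lemma compactin_point_stabilizer:
  assumes w: "w \<in> V"
  shows "compactin X (fixer (carrier Aut) {w})"
proof -
  define P where "P = product_topology (\<lambda>_. discrete_topology V) V"
  have "\<exists>n. x \<in> gball E n w" if "x \<in> V" for x
    using finite_subset_gball[of w "{x}"] w that by auto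
  \<comment> \<open>\<open>d x\<close> is the radius of some ball around \<open>w\<close> that
    contains \<open>x\<close>; the orbit of \<open>x\<close> stays inside this ball.\<close>
  then obtain d where d: "\<And>x. x \<in> V \<Longrightarrow> x \<in> gball E (d x) w"
    by metis
  define B where "B = (\<Pi>\<^sub>E x\<in>V. gball E (d x) w)"
  have "compactin P B"
    unfolding P_def B_def compactin_PiE
    by (simp add: finite_gball[OF w] gball_subset_vertices[OF w] compactin_discrete_topology)
  moreover have "fixer (carrier Aut) {w} \<subseteq> B"
  proof
    fix g assume "g \<in> fixer (carrier Aut) {w}"
    then have g: "g \<in> carrier Aut" "g w = w" by (auto simp: fixer_def)
    show "g \<in> B"
      unfolding B_def
    proof (rule PiE_I)
      show "g x \<in> gball E (d x) w" if "x \<in> V" for x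
        using aut_gball[OF g(1) w d[OF that]] g(2) by simp
      show "g x = undefined" if "x \<notin> V" for x
        using g(1) that unfolding aut_carrier_iff extensional_def by blast
    qed
  qed
  moreover have "closedin P (fixer (carrier Aut) {w})"
  proof -
    define C1 where "C1 = {f \<in> topspace P. f w = w}"
    define C2 where "C2 = (\<lambda>(x, y). {f \<in> topspace P. ((f x, f y) \<in> E \<longleftrightarrow> (x, y) \<in> E) \<and> (f x = f y \<longrightarrow> x = y)})"
    \<comment> \<open>Every condition on two coordinates is closed, being the preimage of a subset
      of a discrete space.\<close>
    have two: "closedin P {f \<in> topspace P. (f x, f y) \<in> R}" if "x \<in> V" "y \<in> V" for x y R
    proof -
      have "continuous_map P (discrete_topology V) (\<lambda>f. f z)" if "z \<in> V" for z
        unfolding P_def using continuous_map_product_projection[OF that, of "\<lambda>_. discrete_topology V"]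
        by simp
      then have "continuous_map P (prod_topology (discrete_topology V) (discrete_topology V)) (\<lambda>f. (f x, f y))"
        using that by (intro continuous_map_pairedI)
      then have c: "continuous_map P (discrete_topology (V \<times> V)) (\<lambda>f. (f x, f y))"
        by (simp add: prod_topology_discrete_topology)
      have "closedin P {f \<in> topspace P. (f x, f y) \<in> R \<inter> (V \<times> V)}"
        by (rule closedin_continuous_map_preimage[OF c]) simp
      moreover have "{f \<in> topspace P. (f x, f y) \<in> R \<inter> (V \<times> V)} = {f \<in> topspace P. (f x, f y) \<in> R}"
        using that by (auto simp: P_def)
      ultimately show ?thesis by simp
    qed
    \<comment> \<open>\<open>C2\<close> encodes preservation of adjacency and injectivity. Such a
      map fixing \<open>w\<close> preserves all balls around \<open>w\<close>, hence is onto by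
      \<open>inj_on_fixing_bij\<close>.\<close>
    have "fixer (carrier Aut) {w} = C1 \<inter> (\<Inter>z\<in>V \<times> V. C2 z)"
    proof (intro equalityI subsetI)
      fix g assume "g \<in> fixer (carrier Aut) {w}"
      then have g: "g \<in> carrier Aut" "g w = w" by (auto simp: fixer_def)
      moreover have "g \<in> topspace P"
        using aut_PiE[OF g(1)] by (simp add: P_def)
      ultimately show "g \<in> C1 \<inter> (\<Inter>z\<in>V \<times> V. C2 z)"
        unfolding C1_def C2_def aut_carrier_iff bij_betw_def inj_on_def by auto
    next
      fix g assume "g \<in> C1 \<inter> (\<Inter>z\<in>V \<times> V. C2 z)"
      then have g: "g \<in> topspace P" "g w = w" "\<And>x y. x \<in> V \<Longrightarrow> y \<in> V \<Longrightarrow> ((g x, g y) \<in> E \<longleftrightarrow> (x, y) \<in> E)"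
        "inj_on g V"
        by (auto simp: C1_def C2_def inj_on_def)
      have gV: "g \<in> V \<rightarrow> V" "g \<in> extensional V" using g(1) by (auto simp: P_def PiE_iff)
      have "g x \<in> gball E n w" if "x \<in> gball E n w" for n x
        using that
      proof (induction n arbitrary: x)
        case 0
        then show ?case using g(2) by (simp add: gball_def)
      next
        case (Suc n)
        then obtain u where u: "u \<in> gball E n w" "u = x \<or> (u, x) \<in> E"
          unfolding gball_Suc by blast
        have "g u \<in> gball E n w"
          by (rule Suc.IH[OF u(1)])
        moreover have "g u = g x \<or> (g u, g x) \<in> E"
          using u(2) g(3) edge_vertices[of u x] by metis
        ultimately show ?case
          unfolding gball_Suc by blast
      qed
      then have "bij_betw g V V"
        using inj_on_fixing_bij[OF gV(1) g(4) w] by blast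
      then show "g \<in> fixer (carrier Aut) {w}"
        using g gV by (simp add: fixer_def aut_carrier_iff)
    qed
    moreover have "closedin P (C1 \<inter> (\<Inter>z\<in>V \<times> V. C2 z))"
    proof -
      have "closedin P C1"
        using two[OF w w, of "{(w, w)}"] by (simp add: C1_def)
      moreover have "closedin P (C2 z)" if "z \<in> V \<times> V" for z
        using two[of "fst z" "snd z" "{(a, b). ((a, b) \<in> E \<longleftrightarrow> z \<in> E) \<and> (a = b \<longrightarrow> fst z = snd z)}"] that
        by (auto simp: C2_def)
      moreover have "closedin P (\<Inter>z\<in>V \<times> V. C2 z)"
        by (rule closedin_INT) (use w calculation(2) in auto)
      ultimately show ?thesis by (intro closedin_Int)
    qed
    ultimately show ?thesis by simp
  qed
  ultimately have "compactin P (fixer (carrier Aut) {w})"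
    by (rule closed_compactin)
  then show ?thesis
    unfolding graph_aut_topology_def P_def[symmetric] compactin_subtopology
    by (auto simp: fixer_def)
qed

lemma openin_fixer:
  assumes "U \<subseteq> carrier Aut" "finite F" "F \<subseteq> V"
  shows "openin (subtopology X U) (fixer U F)"
  unfolding openin_sub_aut_iff[OF assms(1)]
  by (intro conjI ballI exI[of _ F] assms(2,3)) (auto simp: fixer_def)

lemma closedin_fixer:
  assumes "F \<subseteq> V"
  shows "closedin X (fixer (carrier Aut) F)"
  unfolding closedin_def topspace_aut openin_aut_iff
proof (intro conjI ballI)
  show "fixer (carrier Aut) F \<subseteq> carrier Aut"
    by (auto simp: fixer_def)
  fix g assume "g \<in> carrier Aut - fixer (carrier Aut) F"
  then obtain x where x: "x \<in> F" "g x \<noteq> x"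
    by (auto simp: fixer_def)
  then show "\<exists>F'. finite F' \<and> F' \<subseteq> V \<and>
      (\<forall>h\<in>carrier Aut. (\<forall>x\<in>F'. h x = g x) \<longrightarrow> h \<in> carrier Aut - fixer (carrier Aut) F)"
    using assms by (intro exI[of _ "{x}"]) (force simp: fixer_def)
qed auto

text \<open>The ball contains its centre, so the fixer is a closed subset of the compact stabilizer
  of \<open>v\<close>.\<close>

lemma compactin_fixer_gball:
  assumes "subgroup J Aut" "closedin X J" "v \<in> V"
  shows "compactin X (fixer J (gball E r v))"
proof (rule closed_compactin[OF compactin_point_stabilizer[OF assms(3)]])
  have J: "J \<subseteq> carrier Aut"
    using assms(1) subgroup.subset by blast
  show "fixer J (gball E r v) \<subseteq> fixer (carrier Aut) {v}"
    using J gball_self[of v E r] by (auto simp: fixer_def)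
  have "fixer J (gball E r v) = J \<inter> fixer (carrier Aut) (gball E r v)"
    using J by (auto simp: fixer_def)
  then show "closedin X (fixer J (gball E r v))"
    using closedin_Int[OF assms(2) closedin_fixer[OF gball_subset_vertices[OF assms(3)]]] by simp
qed

text \<open>Evaluation at \<open>x\<close> is continuous into a discrete space, where compact sets
  are finite.\<close>

lemma finite_compact_orbit:
  assumes "compactin X U" "x \<in> V"
  shows "finite ((\<lambda>u. u x) ` U)"
proof -
  have "continuous_map X (discrete_topology V) (\<lambda>g. g x)"
    unfolding continuous_map_def topspace_aut
  proof (intro conjI allI impI)
    show "(\<lambda>g. g x) \<in> carrier Aut \<rightarrow> topspace (discrete_topology V)"
      using aut_in_vertices assms(2) by simp
    show "openin X {g \<in> carrier Aut. g x \<in> W}" for W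
      unfolding openin_aut_iff by (intro conjI ballI exI[of _ "{x}"]) (use assms(2) in auto)
  qed
  from image_compactin[OF assms(1) this] show ?thesis
    by (simp add: compactin_discrete_topology)
qed

section \<open>Finite quotients of compact subgroups\<close>

text \<open>\<open>Y\<close> is finite and \<open>U\<close>-invariant, so \<open>U Mod fixer U Y\<close> embeds into the self-maps of \<open>Y\<close>.\<close>

lemma finite_quotient_fixer:
  assumes U: "subgroup U Aut" and Y: "finite Y" "Y \<subseteq> V" "\<forall>u\<in>U. u ` Y \<subseteq> Y"
  shows "fixer U Y \<lhd> Aut\<lparr>carrier := U\<rparr>" "finite (carrier (Aut\<lparr>carrier := U\<rparr> Mod fixer U Y))"
proof -
  interpret U: group "Aut\<lparr>carrier := U\<rparr>"
    by (rule Aut.subgroup_imp_group[OF U])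
  have UA: "U \<subseteq> carrier Aut"
    using U subgroup.subset by blast
  have inv: "u y \<in> Y" if "u \<in> U" "y \<in> Y" for u y
    using Y(3) that by blast
  have sub: "subgroup (fixer U Y) (Aut\<lparr>carrier := U\<rparr>)"
    by (rule Aut.subgroup_incl[OF subgroup_fixer[OF U Y(2)] U]) (auto simp: fixer_def)
  show nor: "fixer U Y \<lhd> Aut\<lparr>carrier := U\<rparr>"
    unfolding U.normal_inv_iff
  proof (intro conjI sub ballI)
    fix g h assume "g \<in> carrier (Aut\<lparr>carrier := U\<rparr>)" "h \<in> fixer U Y"
    then have g: "g \<in> U" and h: "h \<in> U" "\<forall>y\<in>Y. h y = y"
      by (auto simp: fixer_def)
    have i: "inv\<^bsub>Aut\<^esub> g \<in> U"
      using subgroup.m_inv_closed[OF U g] .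
    have A: "g \<in> carrier Aut" "h \<in> carrier Aut" "inv\<^bsub>Aut\<^esub> g \<in> carrier Aut"
      using UA g h(1) i by auto
    have "(g \<otimes>\<^bsub>Aut\<^esub> h \<otimes>\<^bsub>Aut\<^esub> inv\<^bsub>Aut\<^esub> g) y = y" if "y \<in> Y" for y
    proof -
      have iy: "(inv\<^bsub>Aut\<^esub> g) y \<in> Y" "y \<in> V" "(inv\<^bsub>Aut\<^esub> g) y \<in> V"
        using Y(2) inv[OF i that] that by auto
      then show ?thesis
        using A h(2) aut_inv_apply[OF A(1) iy(2)]
        by (simp add: mult_aut_apply[OF Aut.m_closed[OF A(1,2)] A(3)] mult_aut_apply[OF A(1,2)])
    qed
    moreover have "g \<otimes>\<^bsub>Aut\<^esub> h \<otimes>\<^bsub>Aut\<^esub> inv\<^bsub>Aut\<^esub> g \<in> U"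
      using subgroup.m_closed[OF U] g h(1) i by blast
    ultimately show "g \<otimes>\<^bsub>Aut\<lparr>carrier := U\<rparr>\<^esub> h \<otimes>\<^bsub>Aut\<lparr>carrier := U\<rparr>\<^esub> inv\<^bsub>Aut\<lparr>carrier := U\<rparr>\<^esub> g \<in> fixer U Y"
      using Aut.m_inv_consistent[OF U g] by (simp add: fixer_def)
  qed
  \<comment> \<open>The fibres of restriction to \<open>Y\<close>. Each coset of
    \<open>fixer U Y\<close> is such a fibre, indexed by one of the finitely many maps from
    \<open>Y\<close> to \<open>Y\<close>.\<close>
  define C where "C = (\<lambda>t. {h \<in> U. restrict h Y = t})"
  have "fixer U Y #>\<^bsub>Aut\<lparr>carrier := U\<rparr>\<^esub> g = C (restrict g Y)" if g: "g \<in> U" for g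
  proof (intro equalityI subsetI)
    have gA: "g \<in> carrier Aut" "inv\<^bsub>Aut\<^esub> g \<in> U" "inv\<^bsub>Aut\<^esub> g \<in> carrier Aut"
      using g UA subgroup.m_inv_closed[OF U g] by auto
    fix h
    {
      assume "h \<in> fixer U Y #>\<^bsub>Aut\<lparr>carrier := U\<rparr>\<^esub> g"
      then obtain k where k: "k \<in> fixer U Y" "h = k \<otimes>\<^bsub>Aut\<^esub> g"
        by (auto simp: r_coset_def)
      then have kU: "k \<in> U" "k \<in> carrier Aut"
        using UA by (auto simp: fixer_def)
      have "h y = g y" if "y \<in> Y" for y
        using k inv[OF g that] that Y(2) mult_aut_apply[OF kU(2) gA(1)] by (auto simp: fixer_def)
      moreover have "h \<in> U"
        using k(2) kU(1) g subgroup.m_closed[OF U] by blast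
      ultimately show "h \<in> C (restrict g Y)"
        by (auto simp: C_def intro: restrict_ext)
    }
    assume "h \<in> C (restrict g Y)"
    then have h: "h \<in> U" "restrict h Y = restrict g Y"
      by (auto simp: C_def)
    then have eq: "h y = g y" if "y \<in> Y" for y
      using that by (metis restrict_apply')
    have hA: "h \<in> carrier Aut" using h UA by blast
    define k where "k = h \<otimes>\<^bsub>Aut\<^esub> inv\<^bsub>Aut\<^esub> g"
    have "k \<in> U"
      unfolding k_def using subgroup.m_closed[OF U h(1) gA(2)] .
    moreover have "k y = y" if "y \<in> Y" for y
    proof -
      have "y \<in> V" "(inv\<^bsub>Aut\<^esub> g) y \<in> Y"
        using that Y(2) inv[OF gA(2) that] by auto
      then show ?thesis
        unfolding k_def using mult_aut_apply[OF hA gA(3)] eq aut_inv_apply[OF gA(1)] by simp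
    qed
    ultimately have "k \<in> fixer U Y"
      by (simp add: fixer_def)
    moreover have "h = k \<otimes>\<^bsub>Aut\<^esub> g"
      unfolding k_def using hA gA by (simp add: Aut.m_assoc)
    ultimately show "h \<in> fixer U Y #>\<^bsub>Aut\<lparr>carrier := U\<rparr>\<^esub> g"
      by (auto simp: r_coset_def)
  qed
  then have "carrier (Aut\<lparr>carrier := U\<rparr> Mod fixer U Y) \<subseteq> C ` (Y \<rightarrow>\<^sub>E Y)"
    unfolding carrier_FactGroup using inv by fastforce
  then show "finite (carrier (Aut\<lparr>carrier := U\<rparr> Mod fixer U Y))"
    by (rule finite_subset) (simp add: Y(1) finite_PiE)
qed

lemma quotient_pow:
  fixes n :: nat
  assumes "N \<lhd> Aut\<lparr>carrier := U\<rparr>" "g \<in> U"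
  shows "(N #>\<^bsub>Aut\<lparr>carrier := U\<rparr>\<^esub> g) [^]\<^bsub>Aut\<lparr>carrier := U\<rparr> Mod N\<^esub> n = N #>\<^bsub>Aut\<lparr>carrier := U\<rparr>\<^esub> (g [^]\<^bsub>Aut\<^esub> n)"
  using normal.FactGroup_pow[OF assms(1), of g n] assms(2) by (simp add: nat_pow_def)

lemma pow_in_subgroup:
  fixes n :: nat
  assumes "subgroup U Aut" "g \<in> U"
  shows "g [^]\<^bsub>Aut\<^esub> n \<in> U"
  by (induction n) (auto simp: assms subgroup.one_closed subgroup.m_closed)

lemma coset_eq_one_iff:
  assumes "subgroup U Aut" "N \<lhd> Aut\<lparr>carrier := U\<rparr>" "g \<in> U"
  shows "N #>\<^bsub>Aut\<lparr>carrier := U\<rparr>\<^esub> g = N \<longleftrightarrow> g \<in> N"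
proof -
  interpret U: group "Aut\<lparr>carrier := U\<rparr>"
    by (rule Aut.subgroup_imp_group[OF assms(1)])
  have N: "subgroup N (Aut\<lparr>carrier := U\<rparr>)"
    using assms(2) normal_imp_subgroup by blast
  show ?thesis
    using U.coset_join1[OF _ _ N] U.coset_join2[OF _ N] assms(3) subgroup.subset[OF N] by auto
qed

text \<open>Lagrange's theorem in the quotient: raising \<open>g\<close> to the order of the
  quotient lands in the kernel \<open>fixer U Y\<close>.\<close>

lemma exponent_on_invariant_set:
  assumes U: "subgroup U Aut" and Y: "finite Y" "Y \<subseteq> V" "\<forall>u\<in>U. u ` Y \<subseteq> Y"
    and "g \<in> U" "y \<in> Y"
  shows "(g ^^ order (Aut\<lparr>carrier := U\<rparr> Mod fixer U Y)) y = y"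
proof -
  define Q where "Q = Aut\<lparr>carrier := U\<rparr> Mod fixer U Y"
  have n: "fixer U Y \<lhd> Aut\<lparr>carrier := U\<rparr>"
    by (rule finite_quotient_fixer(1)[OF U Y])
  interpret Q: group Q
    unfolding Q_def by (rule normal.factorgroup_is_group[OF n])
  have "fixer U Y #>\<^bsub>Aut\<lparr>carrier := U\<rparr>\<^esub> g \<in> carrier Q"
    unfolding Q_def carrier_FactGroup using \<open>g \<in> U\<close> by simp
  from Q.pow_order_eq_1[OF this] have "fixer U Y #>\<^bsub>Aut\<lparr>carrier := U\<rparr>\<^esub> (g [^]\<^bsub>Aut\<^esub> order Q) = fixer U Y"
    unfolding Q_def using quotient_pow[OF n \<open>g \<in> U\<close>] by simp
  then have "g [^]\<^bsub>Aut\<^esub> order Q \<in> fixer U Y"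
    using coset_eq_one_iff[OF U n pow_in_subgroup[OF U \<open>g \<in> U\<close>]] by blast
  then have "(g [^]\<^bsub>Aut\<^esub> order Q) y = y"
    using \<open>y \<in> Y\<close> by (simp add: fixer_def)
  moreover have "g \<in> carrier Aut" "y \<in> V"
    using U \<open>g \<in> U\<close> subgroup.subset Y(2) \<open>y \<in> Y\<close> by blast+
  ultimately show ?thesis
    using pow_aut_apply[of g y "order Q"] unfolding Q_def by simp
qed

section \<open>From pro-\<pi> subgroups to rigid balls\<close>

text \<open>Since \<open>U\<close> is compact, the union \<open>Y\<close> of the
  \<open>U\<close>-orbits meeting \<open>F\<close> is finite. The quotient by the open subgroup
  \<open>fixer U Y\<close> is a finite continuous one, and its order serves as
  \<open>m\<close>.\<close>

lemma pro_group_exponent: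
  assumes U: "subgroup U Aut" and pro: "pro_group \<pi> (Aut\<lparr>carrier := U\<rparr>) (subtopology X U)"
    and F: "finite F" "F \<subseteq> V"
  obtains m where "m > 0" "\<And>p. prime p \<Longrightarrow> p dvd m \<Longrightarrow> p \<in> \<pi>"
    "\<And>g x. g \<in> U \<Longrightarrow> x \<in> F \<Longrightarrow> (g ^^ m) x = x"
proof -
  have UA: "U \<subseteq> carrier Aut"
    using U subgroup.subset by blast
  have "compact_space (subtopology X U)"
    using pro unfolding pro_group_def profinite_group_def by blast
  then have comp: "compactin X U"
    using UA topspace_aut by (simp add: compact_space_subtopology compactin_subspace)
  define Y where "Y = (\<Union>x\<in>F. (\<lambda>u. u x) ` U)"
  have Y: "finite Y" "Y \<subseteq> V"
    using finite_compact_orbit[OF comp] F UA aut_in_vertices unfolding Y_def by (auto, blast)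
  have inv: "u y \<in> Y" if "u \<in> U" "y \<in> Y" for u y
  proof -
    obtain x k where "x \<in> F" "k \<in> U" "y = k x"
      using \<open>y \<in> Y\<close> by (auto simp: Y_def)
    moreover have "(u \<otimes>\<^bsub>Aut\<^esub> k) x = u (k x)"
      using UA F(2) \<open>x \<in> F\<close> \<open>k \<in> U\<close> \<open>u \<in> U\<close> by (intro mult_aut_apply) auto
    ultimately show ?thesis
      unfolding Y_def using subgroup.m_closed[OF U \<open>u \<in> U\<close>] by (metis UN_I image_eqI)
  qed
  have FY: "F \<subseteq> Y"
  proof
    fix x assume x: "x \<in> F"
    then have "\<one>\<^bsub>Aut\<^esub> x = x"
      using F(2) one_aut_apply by blast
    then show "x \<in> Y"
      unfolding Y_def using x subgroup.one_closed[OF U] by (metis UN_I image_eqI)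
  qed
  then have invY: "\<forall>u\<in>U. u ` Y \<subseteq> Y"
    using inv by blast
  note quot = finite_quotient_fixer[OF U Y invY]
  define m where "m = order (Aut\<lparr>carrier := U\<rparr> Mod fixer U Y)"
  show thesis
  proof (rule that)
    show "m > 0"
      unfolding m_def order_def using quot group.is_monoid[OF normal.factorgroup_is_group[OF quot(1)]]
      by (metis card_gt_0_iff empty_iff monoid.one_closed)
    show "p \<in> \<pi>" if "prime p" "p dvd m" for p
      using pro quot openin_fixer[OF UA Y] that unfolding m_def pro_group_def by blast
    show "(g ^^ m) x = x" if "g \<in> U" "x \<in> F" for g x
      unfolding m_def using exponent_on_invariant_set[OF U Y invY that(1)] FY that(2) by blast
  qed
qed

text \<open>An element fixing a large ball lies in the open pro-\<pi> subgroup. On the next ball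
  both its \<open>p\<close>-th power and an \<open>m\<close>-th power with \<open>m\<close> prime to
  \<open>p\<close> act trivially, hence so does the element. The statement covers all large
  \<open>r\<close> so that finitely many centres can share one radius.\<close>

lemma locally_pro_imp_pi_rigid:
  assumes H: "subgroup H Aut" and "locally_pro_group \<pi> (Aut\<lparr>carrier := H\<rparr>) (subtopology X H)"
    and w: "w \<in> V"
  shows "\<exists>r0. \<forall>r\<ge>r0. pi_rigid E \<pi> H w r"
proof -
  have HA: "H \<subseteq> carrier Aut"
    using H subgroup.subset by blast
  obtain U where U: "subgroup U (Aut\<lparr>carrier := H\<rparr>)" "openin (subtopology X H) U"
    "pro_group \<pi> (Aut\<lparr>carrier := U\<rparr>) (subtopology (subtopology X H) U)"
    using assms(2) unfolding locally_pro_group_def by auto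
  have UA: "subgroup U Aut"
    by (rule Aut.incl_subgroup[OF H U(1)])
  have UH: "U \<subseteq> H"
    using subgroup.subset[OF U(1)] by simp
  then have pro: "pro_group \<pi> (Aut\<lparr>carrier := U\<rparr>) (subtopology X U)"
    using U(3) by (simp add: subtopology_subtopology Int_absorb1)
  have "\<one>\<^bsub>Aut\<^esub> \<in> U"
    by (rule subgroup.one_closed[OF UA])
  then obtain F where F: "finite F" "F \<subseteq> V" "\<forall>h\<in>H. (\<forall>x\<in>F. h x = \<one>\<^bsub>Aut\<^esub> x) \<longrightarrow> h \<in> U"
    using U(2) unfolding openin_sub_aut_iff[OF HA] by blast
  \<comment> \<open>For every \<open>r \<ge> r0\<close> the fixer of the \<open>r\<close>-ball in
    \<open>H\<close> is contained in \<open>U\<close>.\<close>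
  obtain r0 where r0: "F \<subseteq> gball E r0 w"
    using finite_subset_gball[OF w F(1,2)] .
  have "pi_rigid E \<pi> H w r" if "r \<ge> r0" for r
    unfolding pi_rigid_def
  proof (intro ballI allI impI)
    fix g p x
    assume g: "g \<in> fixer H (gball E r w)"
      and p: "prime p \<and> p \<notin> \<pi> \<and> (\<forall>x\<in>gball E (Suc r) w. (g ^^ p) x = x)"
      and x: "x \<in> gball E (Suc r) w"
    have "g y = \<one>\<^bsub>Aut\<^esub> y" if "y \<in> F" for y
    proof -
      have "y \<in> gball E r w" "y \<in> V"
        using that r0 gball_mono[OF \<open>r \<ge> r0\<close>, of E w] F(2) by auto
      then show ?thesis
        using g one_aut_apply by (simp add: fixer_def)
    qed
    then have gU: "g \<in> U"
      using F(3) g unfolding fixer_def by blast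
    obtain m where m: "m > 0" "\<And>p. prime p \<Longrightarrow> p dvd m \<Longrightarrow> p \<in> \<pi>"
      "\<And>g x. g \<in> U \<Longrightarrow> x \<in> gball E (Suc r) w \<Longrightarrow> (g ^^ m) x = x"
      using pro_group_exponent[OF UA pro finite_gball[OF w] gball_subset_vertices[OF w]] by metis
    have "coprime p m"
      using p m(2) prime_imp_coprime by blast
    then show "g x = x"
      using fixed_if_coprime_funpow_fixed[of p g x m] p x m(3)[OF gU x] by blast
  qed
  then show ?thesis by blast
qed

section \<open>Spreading fixed balls, and the return to pro-\<pi> subgroups\<close>

text \<open>\<open>pi_rigid\<close> removes one factor \<open>p\<close> from the exponent at a time:
  it is applied to the power \<open>h\<close> of \<open>g\<close> with exponent
  \<open>p ^ a\<close>, whose \<open>p\<close>-th power is trivial on the larger ball.\<close>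

lemma prime_power_fixed_imp_fixed:
  assumes "pi_rigid E \<pi> J w r" "subgroup J Aut" "prime p" "p \<notin> \<pi>" "w \<in> V"
    and "g \<in> J" "\<forall>x\<in>gball E r w. g x = x" "\<forall>x\<in>gball E (Suc r) w. (g ^^ (p ^ a)) x = x"
  shows "\<forall>x\<in>gball E (Suc r) w. g x = x"
  using assms(8)
proof (induction a)
  case 0
  then show ?case by simp
next
  case (Suc a)
  define h where "h = g [^]\<^bsub>Aut\<^esub> (p ^ a)"
  have hJ: "h \<in> J"
    unfolding h_def by (rule pow_in_subgroup[OF assms(2,6)])
  have A: "h \<in> carrier Aut" "g \<in> carrier Aut"
    using hJ assms(2,6) subgroup.subset by blast+
  have hx: "h x = (g ^^ (p ^ a)) x" if "x \<in> V" for x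
    unfolding h_def using pow_aut_apply[OF A(2) that] .
  have VV: "gball E n w \<subseteq> V" for n
    by (rule gball_subset_vertices[OF assms(5)])
  have "h x = x" if "x \<in> gball E r w" for x
    using funpow_mult_fixed[of 1 g x "p ^ a"] assms(7) that hx VV by (auto simp: subset_iff)
  then have "h \<in> fixer J (gball E r w)"
    using hJ by (simp add: fixer_def)
  moreover have "(h ^^ p) x = x" if "x \<in> gball E (Suc r) w" for x
  proof -
    have xV: "x \<in> V" using that VV by blast
    have "(h ^^ p) x = (h [^]\<^bsub>Aut\<^esub> p) x"
      using pow_aut_apply[OF A(1) xV] by simp
    also have "h [^]\<^bsub>Aut\<^esub> p = g [^]\<^bsub>Aut\<^esub> (p ^ Suc a)"
      unfolding h_def by (simp add: Aut.nat_pow_pow[OF A(2)] mult.commute)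
    also have "(g [^]\<^bsub>Aut\<^esub> (p ^ Suc a)) x = (g ^^ (p ^ Suc a)) x"
      by (rule pow_aut_apply[OF A(2) xV])
    also have "\<dots> = x"
      using Suc.prems that by blast
    finally show ?thesis .
  qed
  ultimately have "\<forall>x\<in>gball E (Suc r) w. h x = x"
    using assms(1,3,4) unfolding pi_rigid_def by blast
  then show ?case
    using Suc.IH hx VV by (metis subsetD)
qed

text \<open>If \<open>g\<close> fixes the ball of radius \<open>r + t\<close> around \<open>v\<close>, it fixes the \<open>r\<close>-balls centred at
  distance \<open>t\<close> from \<open>v\<close>, hence the \<open>(r + 1)\<close>-balls with these centres, and these cover the
  ball of radius \<open>r + t + 1\<close>.\<close>

lemma prime_power_fixes_ball:
  assumes J: "subgroup J Aut" and loc: "\<And>w. w \<in> V \<Longrightarrow> pi_rigid E \<pi> J w r"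
    and p: "prime p" "p \<notin> \<pi>" and v: "v \<in> V"
    and g: "g \<in> J" "\<forall>x\<in>gball E r v. g x = x" "\<forall>x\<in>gball E s v. (g ^^ (p ^ a)) x = x"
  shows "r + t \<le> s \<Longrightarrow> \<forall>x\<in>gball E (r + t) v. g x = x"
proof (induction t)
  case 0
  then show ?case using g(2) by simp
next
  case (Suc t)
  have IH: "\<forall>x\<in>gball E (r + t) v. g x = x"
    using Suc by simp
  show ?case
  proof
    fix x assume "x \<in> gball E (r + Suc t) v"
    then have "x \<in> gball E (t + Suc r) v" by (simp add: add.commute)
    then obtain w where w: "w \<in> gball E t v" "x \<in> gball E (Suc r) w"
      unfolding gball_add by blast
    have wV: "w \<in> V" using w(1) gball_subset_vertices[OF v] by blast
    \<comment> \<open>The second inclusion is where \<open>r + Suc t \<le> s\<close> enters: the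
      \<open>p ^ a\<close>-th power is known to be trivial only inside the
      \<open>s\<close>-ball.\<close>
    have "gball E r w \<subseteq> gball E (r + t) v" "gball E (Suc r) w \<subseteq> gball E s v"
      using gball_subset_gball[OF w(1)] Suc.prems by auto
    then have "\<forall>y\<in>gball E (Suc r) w. g y = y"
      using IH g(3) by (intro prime_power_fixed_imp_fixed[OF loc[OF wV] J p wV g(1)]) auto
    then show "g x = x" using w(2) by blast
  qed
qed

text \<open>The fixer \<open>U\<close> of a single \<open>r\<close>-ball is compact and open in
  \<open>J\<close>. If a finite continuous quotient had an element \<open>c\<close> of prime order
  \<open>p\<close> outside \<pi>, a lift of \<open>c\<close> raised to a suitable \<open>m\<close>
  prime to \<open>p\<close> would have \<open>p\<close>-power order on a large ball, hence fix it
  and lie in \<open>N\<close>. Then \<open>c\<close> would be killed by both \<open>p\<close> and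
  \<open>m\<close>.\<close>

lemma pi_rigid_imp_locally_pro:
  assumes J: "subgroup J Aut" "closedin X J" and loc: "\<And>w. w \<in> V \<Longrightarrow> pi_rigid E \<pi> J w r"
  shows "locally_pro_group \<pi> (Aut\<lparr>carrier := J\<rparr>) (subtopology X J)"
proof -
  obtain v where v: "v \<in> V"
    using connected unfolding graph_connected_def by blast
  have JA: "J \<subseteq> carrier Aut"
    using J(1) subgroup.subset by blast
  define U where "U = fixer J (gball E r v)"
  have UJ: "U \<subseteq> J" by (auto simp: U_def fixer_def)
  have U: "subgroup U Aut"
    unfolding U_def by (rule subgroup_fixer[OF J(1) gball_subset_vertices[OF v]])
  have UA: "U \<subseteq> carrier Aut" using UJ JA by blast
  have "profinite_group (Aut\<lparr>carrier := U\<rparr>) (subtopology X U)"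
    unfolding profinite_group_def
  proof (intro conjI)
    show "compact_space (subtopology X U)"
      unfolding U_def by (rule compact_space_subtopology[OF compactin_fixer_gball[OF J v]])
  qed (intro topological_group_sub_aut[OF U] Hausdorff_space_subtopology Hausdorff_aut
      totally_disconnected_sub_aut[OF UA])+
  moreover have "p \<in> \<pi>" if N: "N \<lhd> Aut\<lparr>carrier := U\<rparr>" "openin (subtopology X U) N"
    "finite (carrier (Aut\<lparr>carrier := U\<rparr> Mod N))"
    and p: "prime p" "p dvd order (Aut\<lparr>carrier := U\<rparr> Mod N)" for N p
  proof (rule ccontr)
    assume np: "p \<notin> \<pi>"
    define Q where "Q = Aut\<lparr>carrier := U\<rparr> Mod N"
    interpret Q: group Q
      unfolding Q_def by (rule normal.factorgroup_is_group[OF N(1)])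
    obtain c where c: "c \<in> carrier Q" "c \<noteq> \<one>\<^bsub>Q\<^esub>" "c [^]\<^bsub>Q\<^esub> p = \<one>\<^bsub>Q\<^esub>"
      using Q.cauchy_prime_order[of p] N(3) p unfolding Q_def by blast
    then obtain g where g: "g \<in> U" "c = N #>\<^bsub>Aut\<lparr>carrier := U\<rparr>\<^esub> g"
      unfolding Q_def carrier_FactGroup by auto
    have "\<one>\<^bsub>Aut\<^esub> \<in> N"
      using subgroup.one_closed[OF normal_imp_subgroup[OF N(1)]] by simp
    then obtain F where F: "finite F" "F \<subseteq> V" "\<forall>h\<in>U. (\<forall>x\<in>F. h x = \<one>\<^bsub>Aut\<^esub> x) \<longrightarrow> h \<in> N"
      using N(2) unfolding openin_sub_aut_iff[OF UA] by blast
    obtain s0 where s0: "F \<subseteq> gball E s0 v"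
      using finite_subset_gball[OF v F(1,2)] .
    \<comment> \<open>At least \<open>s0\<close>, so that fixing the \<open>s\<close>-ball puts an
      element of \<open>U\<close> into \<open>N\<close>; of the form \<open>r + t\<close>, as
      \<open>prime_power_fixes_ball\<close> requires.\<close>
    define s where "s = r + s0"
    have Fs: "F \<subseteq> gball E s v"
      using s0 gball_mono[of s0 s E v] by (simp add: s_def)
    define Y where "Y = gball E s v"
    have Y: "finite Y" "Y \<subseteq> V"
      unfolding Y_def using finite_gball[OF v] gball_subset_vertices[OF v] by auto
    have "u y \<in> Y" if "u \<in> U" "y \<in> Y" for u y
    proof -
      have "u v = v" "u \<in> carrier Aut"
        using that(1) gball_self[of v E r] UA by (auto simp: U_def fixer_def)
      then show ?thesis
        using aut_gball[of u v y s] v that(2) by (simp add: Y_def)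
    qed
    then have inv: "\<forall>u\<in>U. u ` Y \<subseteq> Y"
      by blast
    define k where "k = order (Aut\<lparr>carrier := U\<rparr> Mod fixer U Y)"
    have "k \<noteq> 0"
      unfolding k_def order_def using finite_quotient_fixer[OF U Y inv]
        group.is_monoid[OF normal.factorgroup_is_group[OF finite_quotient_fixer(1)[OF U Y inv]]]
      by (metis card_eq_0_iff empty_iff monoid.one_closed)
    then obtain m where m: "k = p ^ multiplicity p k * m" "\<not> p dvd m"
      using multiplicity_decompose'[of k p] p(1) prime_gt_1_nat[OF p(1)] by auto
    \<comment> \<open>Since \<open>k\<close> kills the action of \<open>U\<close> on
      \<open>Y\<close>, taking the power \<open>m\<close> leaves an action of \<open>p\<close>-power
      order.\<close>
    define h where "h = g [^]\<^bsub>Aut\<^esub> m"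
    have hU: "h \<in> U"
      unfolding h_def by (rule pow_in_subgroup[OF U g(1)])
    have A: "g \<in> carrier Aut" "h \<in> carrier Aut"
      using g(1) hU UA by auto
    have "(h ^^ (p ^ multiplicity p k)) x = x" if "x \<in> gball E s v" for x
    proof -
      have xV: "x \<in> V" using that Y by (auto simp: Y_def)
      have "(h ^^ (p ^ multiplicity p k)) x = (h [^]\<^bsub>Aut\<^esub> (p ^ multiplicity p k)) x"
        using pow_aut_apply[OF A(2) xV] by simp
      also have "h [^]\<^bsub>Aut\<^esub> (p ^ multiplicity p k) = g [^]\<^bsub>Aut\<^esub> k"
        unfolding h_def Aut.nat_pow_pow[OF A(1)] using m(1) by (metis mult.commute)
      also have "(g [^]\<^bsub>Aut\<^esub> k) x = (g ^^ k) x"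
        by (rule pow_aut_apply[OF A(1) xV])
      also have "\<dots> = x"
        using exponent_on_invariant_set[OF U Y inv g(1)] that unfolding k_def Y_def by blast
      finally show ?thesis .
    qed
    then have "\<forall>x\<in>gball E (r + s0) v. h x = x"
      using hU UJ unfolding U_def fixer_def
      by (intro prime_power_fixes_ball[OF J(1) loc p(1) np v, where s = s and a = "multiplicity p k"])
        (auto simp: s_def)
    then have "h x = \<one>\<^bsub>Aut\<^esub> x" if "x \<in> F" for x
      using that Fs F(2) one_aut_apply[of x] unfolding s_def by (metis subsetD)
    then have "h \<in> N"
      using F(3) hU by blast
    then have "N #>\<^bsub>Aut\<lparr>carrier := U\<rparr>\<^esub> h = N"
      using coset_eq_one_iff[OF U N(1) hU] by blast
    then have "c [^]\<^bsub>Q\<^esub> m = \<one>\<^bsub>Q\<^esub>"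
      using quotient_pow[OF N(1) g(1), of m] unfolding Q_def g(2) h_def by simp
    moreover have "coprime p m"
      using p(1) m(2) prime_imp_coprime by blast
    ultimately show False
      using Q.eq_one_if_coprime_powers[OF c(1) c(3)] c(2) by blast
  qed
  ultimately have pro: "pro_group \<pi> (Aut\<lparr>carrier := U\<rparr>) (subtopology X U)"
    unfolding pro_group_def by blast
  show ?thesis
    unfolding locally_pro_group_def
  proof (intro exI[of _ U] conjI)
    show "subgroup U (Aut\<lparr>carrier := J\<rparr>)"
      by (rule Aut.subgroup_incl[OF U J(1) UJ])
    show "openin (subtopology X J) U"
      unfolding U_def
      by (rule openin_fixer[OF JA finite_gball[OF v] gball_subset_vertices[OF v]])
    show "pro_group \<pi> (Aut\<lparr>carrier := J\<rparr>\<lparr>carrier := U\<rparr>) (subtopology (subtopology X J) U)"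
      using pro UJ by (simp add: subtopology_subtopology Int_absorb1)
  qed
qed

section \<open>Chabauty neighborhoods and vertex orbits\<close>

text \<open>Conjugation by \<open>j\<close> preserves \<open>J\<close> and carries fixers of balls
  around \<open>x\<close> to fixers of balls around \<open>j x\<close>, so the test for
  \<open>g\<close> at \<open>x\<close> becomes the test for \<open>h\<close> at
  \<open>j x\<close>.\<close>

lemma pi_rigid_conjugate:
  assumes J: "subgroup J Aut" and j: "j \<in> J" and x: "x \<in> V" and loc: "pi_rigid E \<pi> J (j x) r"
  shows "pi_rigid E \<pi> J x r"
  unfolding pi_rigid_def
proof (intro ballI allI impI)
  fix g p z
  assume g: "g \<in> fixer J (gball E r x)"
    and p: "prime p \<and> p \<notin> \<pi> \<and> (\<forall>z\<in>gball E (Suc r) x. (g ^^ p) z = z)"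
    and z: "z \<in> gball E (Suc r) x"
  define i where "i = inv\<^bsub>Aut\<^esub> j"
  define h where "h = j \<otimes>\<^bsub>Aut\<^esub> g \<otimes>\<^bsub>Aut\<^esub> i"
  have gJ: "g \<in> J" using g by (simp add: fixer_def)
  have iJ: "i \<in> J" unfolding i_def by (rule subgroup.m_inv_closed[OF J j])
  have hJ: "h \<in> J"
    unfolding h_def using subgroup.m_closed[OF J] j gJ iJ by blast
  have A: "j \<in> carrier Aut" "g \<in> carrier Aut" "i \<in> carrier Aut"
    using subgroup.subset[OF J] j gJ iJ by auto
  have ij: "i (j y) = y" "j (i y) = y" if "y \<in> V" for y
    unfolding i_def using inv_aut_apply[OF A(1) that] aut_inv_apply[OF A(1) that] by auto
  have V: "j y \<in> V" "g y \<in> V" "i y \<in> V" if "y \<in> V" for y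
    using aut_in_vertices A that by auto
  have h: "h y = j (g (i y))" if "y \<in> V" for y
    unfolding h_def using that
    by (simp add: mult_aut_apply[OF Aut.m_closed[OF A(1,2)] A(3)] mult_aut_apply[OF A(1,2)] V)
  have pow: "(h ^^ n) y = j ((g ^^ n) (i y))" if "y \<in> V" for n y
  proof -
    \<comment> \<open>Membership in \<open>V\<close> is carried through the induction because
      \<open>i\<close> and \<open>j\<close> cancel only on vertices.\<close>
    have "(h ^^ n) y = j ((g ^^ n) (i y)) \<and> (g ^^ n) (i y) \<in> V"
      by (induction n) (use that V in \<open>auto simp: ij h\<close>)
    then show ?thesis ..
  qed
  have jxV: "j x \<in> V" using V x by blast
  have ball: "y \<in> V" "i y \<in> gball E n x" if "y \<in> gball E n (j x)" for y n
  proof -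
    show "y \<in> V" using that gball_subset_vertices[OF jxV] by blast
    show "i y \<in> gball E n x" using aut_gball[OF A(3) jxV that] ij(1)[OF x] by simp
  qed
  have "h y = y" if "y \<in> gball E r (j x)" for y
    using ball[OF that] h ij g by (simp add: fixer_def)
  then have "h \<in> fixer J (gball E r (j x))"
    using hJ by (simp add: fixer_def)
  moreover have "(h ^^ p) y = y" if "y \<in> gball E (Suc r) (j x)" for y
    using ball[OF that] pow ij p by simp
  ultimately have fixed: "h y = y" if "y \<in> gball E (Suc r) (j x)" for y
    using loc p that unfolding pi_rigid_def by blast
  have zV: "z \<in> V" using z gball_subset_vertices[OF x] by blast
  have "h (j z) = j z"
    by (rule fixed[OF aut_gball[OF A(1) x z]])
  then have "j (g z) = j z"
    using h[of "j z"] ij(1) V zV by simp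
  then show "g z = z"
    using ij(1) V zV by metis
qed

text \<open>The vertices of a shortest path from \<open>v\<close> to an orbit lie in pairwise distinct orbits:
  otherwise an element of \<open>J\<close> would shorten the path.\<close>

lemma orbit_meets_gball:
  assumes J: "subgroup J Aut" and fin: "finite (vertex_orbits V E J)"
    and card: "card (vertex_orbits V E J) \<le> n" and v: "v \<in> V" and x: "x \<in> V"
  shows "\<exists>j\<in>J. j x \<in> gball E n v"
proof -
  have JA: "J \<subseteq> carrier Aut"
    using subgroup.subset[OF J] .
  define D where "D = (\<lambda>d. \<exists>j\<in>J. j x \<in> gball E d v)"
  have one: "\<one>\<^bsub>Aut\<^esub> \<in> J"
    by (rule subgroup.one_closed[OF J])
  obtain d1 where "{x} \<subseteq> gball E d1 v"
    using finite_subset_gball[OF v, of "{x}"] x by auto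
  then have "D d1"
    unfolding D_def using one one_aut_apply[OF x] by (intro bexI[of _ "\<one>\<^bsub>Aut\<^esub>"]) auto
  define d where "d = (LEAST d. D d)"
  have "D d" unfolding d_def using \<open>D d1\<close> by (rule LeastI)
  then obtain j where j: "j \<in> J" "j x \<in> gball E d v"
    unfolding D_def by blast
  have least: "d \<le> m" if "k \<in> J" "k x \<in> gball E m v" for k m
    unfolding d_def by (rule Least_le) (use that in \<open>auto simp: D_def\<close>)
  \<comment> \<open>A priori the path may stand still; the injectivity shown below rules this
    out.\<close>
  obtain f where f: "f 0 = v" "f d = j x" "\<And>i. i < d \<Longrightarrow> (f i, f (Suc i)) \<in> E\<^sup>="
    using j(2) unfolding gball_iff relpow_fun_conv by blast
  have path: "f (i + k) \<in> gball E k (f i)" if "i + k \<le> d" for i k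
    unfolding gball_iff relpow_fun_conv
    by (rule exI[of _ "\<lambda>m. f (i + m)"]) (use f(3) that in auto)
  have fV: "f i \<in> V" if "i \<le> d" for i
    using path[of 0 i] that f(1) gball_subset_vertices[OF v, of i] by auto
  define \<Omega> where "\<Omega> = (\<lambda>y. {k y | k. k \<in> J})"
  have orb: "vertex_orbits V E J = {\<Omega> y | y. y \<in> V}"
    by (simp add: vertex_orbits_def orbits_def orbit_def \<Omega>_def)
  have "inj_on (\<lambda>i. \<Omega> (f i)) {..d}"
  proof (rule linorder_inj_onI)
    fix a b assume ab: "a < b" "a \<in> {..d}" "b \<in> {..d}"
    show "\<Omega> (f a) \<noteq> \<Omega> (f b)"
    proof
      assume eq: "\<Omega> (f a) = \<Omega> (f b)"
      have "f a \<in> \<Omega> (f a)"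
        unfolding \<Omega>_def using one one_aut_apply[OF fV[of a]] ab(2) by (metis (mono_tags, lifting) atMost_iff mem_Collect_eq)
      then have "f a \<in> \<Omega> (f b)"
        using eq by simp
      then obtain k where k: "k \<in> J" "f a = k (f b)"
        by (auto simp: \<Omega>_def)
      have kA: "k \<in> carrier Aut" "j \<in> carrier Aut" using k j JA by auto
      have "k (f d) \<in> gball E (d - b) (f a)"
        using aut_gball[OF kA(1) fV path[of b "d - b"]] ab k(2) by simp
      moreover have "f a \<in> gball E a v"
        using path[of 0 a] ab f(1) by simp
      ultimately have "k (f d) \<in> gball E (a + (d - b)) v"
        by (rule gball_trans[rotated])
      moreover have "k (f d) = (k \<otimes>\<^bsub>Aut\<^esub> j) x"
        using mult_aut_apply[OF kA x] f(2) by simp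
      ultimately have "d \<le> a + (d - b)"
        using least subgroup.m_closed[OF J k(1) j(1)] by metis
      then show False using ab by simp
    qed
  qed auto
  \<comment> \<open>The path has \<open>d + 1\<close> vertices, so this even gives
    \<open>d < n\<close>.\<close>
  then have "card {..d} \<le> card (vertex_orbits V E J)"
    using fin fV by (intro card_inj_on_le[where f = "\<lambda>i. \<Omega> (f i)"]) (auto simp: orb)
  then have "d \<le> n"
    using card by simp
  then show ?thesis
    using j gball_mono[of d n E v] by blast
qed

text \<open>Elements of a nearby \<open>J\<close> that fix some \<open>w\<close> in the
  \<open>n\<close>-ball are approximated by elements of \<open>H\<close> with the same action on the
  \<open>(r + 1)\<close>-ball around \<open>w\<close>, and \<open>pi_rigid\<close> depends on that
  action alone. The radius \<open>r\<close> found for \<open>H\<close> therefore works for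
  \<open>J\<close>.\<close>

lemma openin_pi_rigid:
  assumes v: "v \<in> V"
  shows "openin (chabauty_topology Aut X)
    {J \<in> closed_subgroups Aut X. \<exists>r. \<forall>w\<in>gball E n v. pi_rigid E \<pi> J w r}"
    (is "openin _ ?T")
  unfolding openin_chabauty_topology
proof (intro conjI ballI)
  show "?T \<subseteq> closed_subgroups Aut X" by blast
  fix H assume "H \<in> ?T"
  then obtain r where H: "subgroup H Aut" and r: "\<forall>w\<in>gball E n v. pi_rigid E \<pi> H w r"
    unfolding closed_subgroups_def by blast
  have HA: "H \<subseteq> carrier Aut" using subgroup.subset[OF H] .
  have VV: "gball E m v \<subseteq> V" for m by (rule gball_subset_vertices[OF v])
  \<comment> \<open>A finite union of compact stabilizers that contains every automorphism to be
    tested at a centre in the \<open>n\<close>-ball. The ball \<open>B\<close> below contains all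
    the \<open>(r + 1)\<close>-balls around these centres.\<close>
  define K where "K = (\<Union>w\<in>gball E n v. fixer (carrier Aut) {w})"
  define B where "B = gball E (n + Suc r) v"
  define U where "U = fixer (carrier Aut) B"
  have K: "compactin X K"
    unfolding K_def
  proof (rule compactin_Union)
    show "finite ((\<lambda>w. fixer (carrier Aut) {w}) ` gball E n v)"
      using finite_gball[OF v] by simp
    show "compactin X S" if "S \<in> (\<lambda>w. fixer (carrier Aut) {w}) ` gball E n v" for S
      using that VV compactin_point_stabilizer by blast
  qed
  have U: "openin X U"
    using openin_fixer[of "carrier Aut" B] finite_gball[OF v] VV
    unfolding U_def B_def by (simp add: subtopology_superset topspace_aut)
  have U1: "\<one>\<^bsub>Aut\<^esub> \<in> U"
    using VV one_aut_apply unfolding U_def B_def fixer_def by blast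
  have "chabauty_nhd Aut X H K U \<subseteq> ?T"
  proof
    fix J assume J: "J \<in> chabauty_nhd Aut X H K U"
    then have Jc: "J \<in> closed_subgroups Aut X" and JH: "J \<inter> K \<subseteq> H <#>\<^bsub>Aut\<^esub> U"
      unfolding chabauty_nhd_def by auto
    have JA: "J \<subseteq> carrier Aut"
      using Jc subgroup.subset unfolding closed_subgroups_def by blast
    have "pi_rigid E \<pi> J w r" if w: "w \<in> gball E n v" for w
      unfolding pi_rigid_def
    proof (intro ballI allI impI)
      fix g p z
      assume g: "g \<in> fixer J (gball E r w)"
        and p: "prime p \<and> p \<notin> \<pi> \<and> (\<forall>z\<in>gball E (Suc r) w. (g ^^ p) z = z)"
        and z: "z \<in> gball E (Suc r) w"
      have wV: "w \<in> V" using w VV by blast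
      have gA: "g \<in> carrier Aut" "g \<in> J" using g JA by (auto simp: fixer_def)
      have gw: "g w = w" using g gball_self[of w E r] by (simp add: fixer_def)
      have "g \<in> K"
        unfolding K_def fixer_def using w gA gw by blast
      then obtain h u where hu: "h \<in> H" "u \<in> U" "g = h \<otimes>\<^bsub>Aut\<^esub> u"
        using JH gA(2) unfolding set_mult_def by blast
      have hA: "h \<in> carrier Aut" using hu HA by blast
      have uA: "u \<in> carrier Aut" "\<And>y. y \<in> B \<Longrightarrow> u y = y"
        using hu(2) by (auto simp: U_def fixer_def)
      have sub: "gball E (Suc r) w \<subseteq> B"
        unfolding B_def by (rule gball_subset_gball[OF w]) simp
      have hg: "h y = g y" if "y \<in> gball E (Suc r) w" for y
      proof -
        have "y \<in> B" "y \<in> V" using that sub gball_subset_vertices[OF wV] by auto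
        then show ?thesis using mult_aut_apply[OF hA uA(1)] uA(2) hu(3) by simp
      qed
      \<comment> \<open>Invariance of the ball lets the agreement of \<open>h\<close> and
        \<open>g\<close> pass to their iterates.\<close>
      have stable: "g y \<in> gball E (Suc r) w" if "y \<in> gball E (Suc r) w" for y
        using aut_gball[OF gA(1) wV that] gw by simp
      have pow: "(h ^^ m) y = (g ^^ m) y" if "y \<in> gball E (Suc r) w" for m y
      proof -
        have "(h ^^ m) y = (g ^^ m) y \<and> (g ^^ m) y \<in> gball E (Suc r) w"
          by (induction m) (use that stable hg in auto)
        then show ?thesis ..
      qed
      have "h y = y" if "y \<in> gball E r w" for y
      proof -
        have "y \<in> gball E (Suc r) w" using that gball_mono[of r "Suc r" E w] by auto
        then show ?thesis using hg g that by (simp add: fixer_def)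
      qed
      then have "h \<in> fixer H (gball E r w)"
        using hu(1) by (simp add: fixer_def)
      moreover have "\<forall>y\<in>gball E (Suc r) w. (h ^^ p) y = y"
        using pow p by simp
      ultimately have "h z = z"
        using r w p z unfolding pi_rigid_def by blast
      then show "g z = z" using hg[OF z] by simp
    qed
    then show "J \<in> ?T" using Jc by blast
  qed
  then show "\<exists>K U. compactin X K \<and> openin X U \<and> \<one>\<^bsub>Aut\<^esub> \<in> U \<and> chabauty_nhd Aut X H K U \<subseteq> ?T"
    using K U U1 by (intro exI[of _ K] exI[of _ U]) simp
qed

lemma locally_pro_imp_uniformly_pi_rigid:
  assumes H: "subgroup H Aut" and pro: "locally_pro_group \<pi> (Aut\<lparr>carrier := H\<rparr>) (subtopology X H)"
    and W: "finite W" "W \<subseteq> V"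
  shows "\<exists>r. \<forall>w\<in>W. pi_rigid E \<pi> H w r"
proof -
  have "\<exists>r0. \<forall>r\<ge>r0. pi_rigid E \<pi> H w r" if "w \<in> W" for w
    using locally_pro_imp_pi_rigid[OF H pro] that W(2) by blast
  then obtain R where R: "\<And>w r. w \<in> W \<Longrightarrow> R w \<le> r \<Longrightarrow> pi_rigid E \<pi> H w r"
    by metis
  \<comment> \<open>The sum is a common upper bound of the radii that also makes sense for empty
    \<open>W\<close>.\<close>
  have "R w \<le> (\<Sum>w\<in>W. R w)" if "w \<in> W" for w
    using member_le_sum[of w W R] W(1) that by simp
  then show ?thesis using R by blast
qed

section \<open>Openness of the locally pro-\<pi> groups and the discrete case\<close>

text \<open>Among subgroups with at most \<open>C\<close> orbits, the Chabauty-open condition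
  \<open>T\<close> singles out the locally pro-\<pi> ones: the \<open>n\<close>-ball meets every
  orbit, so rigidity there spreads by conjugation to all vertices with the same
  \<open>r\<close>.\<close>

lemma openin_locally_pro:
  "openin (unimodular_subgroup_space V E C)
     {H \<in> unimodular_subgroups V E C. locally_pro_group \<pi> (Aut\<lparr>carrier := H\<rparr>) (subtopology X H)}"
proof -
  obtain v where v: "v \<in> V"
    using connected unfolding graph_connected_def by blast
  define n where "n = nat \<lfloor>C\<rfloor>"
  define T where "T = {J \<in> closed_subgroups Aut X. \<exists>r. \<forall>w\<in>gball E n v. pi_rigid E \<pi> J w r}"
  have "openin (unimodular_subgroup_space V E C) (T \<inter> unimodular_subgroups V E C)"
    unfolding unimodular_subgroup_space_def T_def
    by (rule openin_subtopology_Int[OF openin_pi_rigid[OF v]])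
  moreover have "T \<inter> unimodular_subgroups V E C =
    {H \<in> unimodular_subgroups V E C. locally_pro_group \<pi> (Aut\<lparr>carrier := H\<rparr>) (subtopology X H)}"
  proof (intro equalityI subsetI)
    fix J assume J: "J \<in> T \<inter> unimodular_subgroups V E C"
    then obtain r where Jc: "subgroup J Aut" "closedin X J" and r: "\<forall>w\<in>gball E n v. pi_rigid E \<pi> J w r"
      unfolding T_def closed_subgroups_def by blast
    have orb: "finite (vertex_orbits V E J)" "real (card (vertex_orbits V E J)) \<le> C"
      using J unfolding unimodular_subgroups_def by auto
    have "card (vertex_orbits V E J) \<le> n"
      unfolding n_def using orb(2) by (simp add: le_nat_floor)
    then have "pi_rigid E \<pi> J x r" if "x \<in> V" for x
      using orbit_meets_gball[OF Jc(1) orb(1) _ v that] pi_rigid_conjugate[OF Jc(1) _ that] r by blast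
    from pi_rigid_imp_locally_pro[OF Jc this] J
    show "J \<in> {H \<in> unimodular_subgroups V E C. locally_pro_group \<pi> (Aut\<lparr>carrier := H\<rparr>) (subtopology X H)}"
      by blast
  next
    fix H assume H: "H \<in> {H \<in> unimodular_subgroups V E C. locally_pro_group \<pi> (Aut\<lparr>carrier := H\<rparr>) (subtopology X H)}"
    then have Hc: "H \<in> closed_subgroups Aut X" "subgroup H Aut"
      unfolding unimodular_subgroups_def closed_subgroups_def by auto
    have "\<exists>r. \<forall>w\<in>gball E n v. pi_rigid E \<pi> H w r"
      by (rule locally_pro_imp_uniformly_pi_rigid[OF Hc(2) _ finite_gball[OF v] gball_subset_vertices[OF v]])
        (use H in blast)
    then show "H \<in> T \<inter> unimodular_subgroups V E C"
      unfolding T_def using H Hc(1) by blast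
  qed
  ultimately show ?thesis by simp
qed

text \<open>With no primes allowed, the open subgroup \<open>U\<close> acts trivially on each
  vertex, so it is trivial and translation makes every point of \<open>H\<close> open. Conversely,
  in a discrete group the trivial subgroup is a witness.\<close>

lemma locally_pro_empty_iff_discrete:
  assumes H: "subgroup H Aut"
  shows "locally_pro_group {} (Aut\<lparr>carrier := H\<rparr>) (subtopology X H) \<longleftrightarrow>
    subtopology X H = discrete_topology H"
proof
  have HA: "H \<subseteq> carrier Aut" using subgroup.subset[OF H] .
  {
    assume "subtopology X H = discrete_topology H"
    then have disc: "openin (subtopology X H) S" if "S \<subseteq> H" for S
      using that by simp
    define U where "U = {\<one>\<^bsub>Aut\<^esub>}"
    have UH: "U \<subseteq> H" unfolding U_def using subgroup.one_closed[OF H] by simp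
    have U: "subgroup U Aut" unfolding U_def by (rule Aut.triv_subgroup)
    have UA: "U \<subseteq> carrier Aut" using UH HA by blast
    have "profinite_group (Aut\<lparr>carrier := U\<rparr>) (subtopology X U)"
      unfolding profinite_group_def
    proof (intro conjI)
      show "compact_space (subtopology X U)"
        by (rule compact_space_subtopology, rule finite_imp_compactin)
          (use UA in \<open>auto simp: U_def topspace_aut\<close>)
    qed (intro topological_group_sub_aut[OF U] Hausdorff_space_subtopology Hausdorff_aut
        totally_disconnected_sub_aut[OF UA])+
    moreover have "\<not> p dvd order (Aut\<lparr>carrier := U\<rparr> Mod N)"
      if N: "N \<lhd> Aut\<lparr>carrier := U\<rparr>" and p: "prime p" for N p
    proof -
      have "carrier (Aut\<lparr>carrier := U\<rparr> Mod N) = {N #>\<^bsub>Aut\<lparr>carrier := U\<rparr>\<^esub> \<one>\<^bsub>Aut\<^esub>}"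
        unfolding carrier_FactGroup by (simp add: U_def)
      then have "order (Aut\<lparr>carrier := U\<rparr> Mod N) = 1"
        by (simp add: order_def)
      then show ?thesis using p by (metis not_prime_unit)
    qed
    ultimately have pro: "pro_group {} (Aut\<lparr>carrier := U\<rparr>) (subtopology X U)"
      unfolding pro_group_def by blast
    show "locally_pro_group {} (Aut\<lparr>carrier := H\<rparr>) (subtopology X H)"
      unfolding locally_pro_group_def
    proof (intro exI[of _ U] conjI disc UH)
      show "subgroup U (Aut\<lparr>carrier := H\<rparr>)"
        by (rule Aut.subgroup_incl[OF U H UH])
      show "pro_group {} (Aut\<lparr>carrier := H\<rparr>\<lparr>carrier := U\<rparr>) (subtopology (subtopology X H) U)"
        using pro UH by (simp add: subtopology_subtopology Int_absorb1)
    qed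
  }
  assume "locally_pro_group {} (Aut\<lparr>carrier := H\<rparr>) (subtopology X H)"
  then obtain U where U: "subgroup U (Aut\<lparr>carrier := H\<rparr>)" "openin (subtopology X H) U"
    "pro_group {} (Aut\<lparr>carrier := U\<rparr>) (subtopology (subtopology X H) U)"
    unfolding locally_pro_group_def by auto
  have UA: "subgroup U Aut"
    by (rule Aut.incl_subgroup[OF H U(1)])
  have UH: "U \<subseteq> H"
    using subgroup.subset[OF U(1)] by simp
  then have pro: "pro_group {} (Aut\<lparr>carrier := U\<rparr>) (subtopology X U)"
    using U(3) by (simp add: subtopology_subtopology Int_absorb1)
  have triv: "u x = x" if u: "u \<in> U" and x: "x \<in> V" for u x
  proof -
    have fx: "finite {x}" "{x} \<subseteq> V" using x by auto
    obtain m where m: "m > 0" "\<And>p. prime p \<Longrightarrow> p dvd m \<Longrightarrow> p \<in> {}"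
      "\<And>g y. g \<in> U \<Longrightarrow> y \<in> {x} \<Longrightarrow> (g ^^ m) y = y"
      using pro_group_exponent[OF UA pro fx] by metis
    \<comment> \<open>Any other number has a prime divisor, which would have to lie in the empty
      set.\<close>
    then have "m = 1"
      using prime_factor_nat[of m] by blast
    then show ?thesis using m(3)[OF u, of x] by simp
  qed
  have "\<one>\<^bsub>Aut\<^esub> \<in> U"
    by (rule subgroup.one_closed[OF UA])
  then obtain F where F: "finite F" "F \<subseteq> V" "\<forall>h\<in>H. (\<forall>x\<in>F. h x = \<one>\<^bsub>Aut\<^esub> x) \<longrightarrow> h \<in> U"
    using U(2) unfolding openin_sub_aut_iff[OF HA] by blast
  \<comment> \<open>Left translation by the inverse of \<open>g\<close> reduces this to the
    identity, so the one finite set \<open>F\<close> separates all elements of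
    \<open>H\<close>.\<close>
  have sep: "h = g" if g: "g \<in> H" and h: "h \<in> H" and eq: "\<forall>x\<in>F. h x = g x" for g h
  proof -
    define k where "k = inv\<^bsub>Aut\<^esub> g \<otimes>\<^bsub>Aut\<^esub> h"
    have A: "g \<in> carrier Aut" "h \<in> carrier Aut" "inv\<^bsub>Aut\<^esub> g \<in> carrier Aut"
      using g h HA by auto
    have kx: "k x = (inv\<^bsub>Aut\<^esub> g) (h x)" if "x \<in> V" for x
      unfolding k_def by (rule mult_aut_apply[OF A(3,2) that])
    have "k x = \<one>\<^bsub>Aut\<^esub> x" if "x \<in> F" for x
      using that eq F(2) kx[of x] inv_aut_apply[OF A(1), of x] one_aut_apply[of x] by auto
    moreover have "k \<in> H"
      unfolding k_def using subgroup.m_closed[OF H subgroup.m_inv_closed[OF H g] h] .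
    ultimately have kU: "k \<in> U" using F(3) by blast
    show "h = g"
    proof (rule aut_eqI[OF A(2,1)])
      fix x assume x: "x \<in> V"
      have "(inv\<^bsub>Aut\<^esub> g) (h x) = x"
        using triv[OF kU x] kx[OF x] by simp
      then show "h x = g x"
        using aut_inv_apply[OF A(1) aut_in_vertices[OF A(2) x]] by simp
    qed
  qed
  have "openin (subtopology X H) S" if "S \<subseteq> H" for S
    unfolding openin_sub_aut_iff[OF HA]
  proof (intro conjI ballI that exI[of _ F] F(1,2) impI)
    fix g h assume "g \<in> S" "h \<in> H" "\<forall>x\<in>F. h x = g x"
    then show "h \<in> S" using sep[of g h] that by auto
  qed
  then show "subtopology X H = discrete_topology H"
    using discrete_topology_unique[of H "subtopology X H"] topspace_sub_aut[OF HA] by simp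
qed

end

theorem proposition5p19:
  fixes V :: "'v set" and E :: "('v \<times> 'v) set" and C :: real
  assumes "tree V E"
    and "locally_finite V E"
    and "\<forall>v\<in>V. vertex_degree E v \<ge> 2"
    and "C > 0"
  shows "(\<forall>\<pi> :: nat set. (\<forall>p\<in>\<pi>. prime p) \<longrightarrow>
            openin (unimodular_subgroup_space V E C)
              {H \<in> unimodular_subgroups V E C.
                 locally_pro_group \<pi> (graph_aut V E\<lparr>carrier := H\<rparr>)
                   (subtopology (graph_aut_topology V E) H)}) \<and>
         openin (unimodular_subgroup_space V E C)
           {H \<in> unimodular_subgroups V E C.
              subtopology (graph_aut_topology V E) H = discrete_topology H}"
proof -
  interpret locally_finite_graph V E
    using assms(1,2) by unfold_locales (auto simp: tree_def)
  \<comment> \<open>The second conjunct is the instance \<open>\<pi> = {}\<close> of openness,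
    rewritten in terms of the discrete topology.\<close>
  have "{H \<in> unimodular_subgroups V E C. locally_pro_group {} (Aut\<lparr>carrier := H\<rparr>) (subtopology X H)} =
      {H \<in> unimodular_subgroups V E C. subtopology X H = discrete_topology H}"
    using locally_pro_empty_iff_discrete
    by (auto simp: unimodular_subgroups_def closed_subgroups_def)
  then have "openin (unimodular_subgroup_space V E C)
      {H \<in> unimodular_subgroups V E C. subtopology X H = discrete_topology H}"
    using openin_locally_pro[of C "{}"] by (simp only:)
  with openin_locally_pro show ?thesis
    by blast
qed

end
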